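(* Let $K$ be a compact metric space and let $f \in DSC(K)\setminus C(K)$. Then $f$ strictly governs the class of separable polyhedral Banach spaces; that is, for every uniformly bounded sequence $(f_n)$ of continuous real functions on $K$ converging pointwise to $f$ on $K$, there exists a convex block sequence $(g_n)$ of $(f_n)$ such that the closed linear span of $(g_n)$ in $C(K)$ (with the supremum norm) is isomorphic to a separable polyhedral Banach space.
   Context: $C(K)$ is the space of continuous real functions on $K$ with the supremum norm. $DSC(K)$ is the set of functions $f:K\to\mathbb{R}$ for which there exists a uniformly bounded sequence $(f_n)\subset C(K)$ with $\lim_n f_n(k)=f(k)$ and $\sum_{n}|f_{n+1}(k)-f_n(k)|<\infty$ for all $k\in K$. A convex block sequence of $(f_n)$ is a sequence $(g_n)$ with $g_n=\sum_{i\in F_n} c_i f_i$, where $F_1<F_2<\cdots$ are finite nonempty sets of positive integers (every element of $F_n$ is less than every element of $F_{n+1}$), $c_i\ge 0$ and $\sum_{i\in F_n}c_i=1$. An infinite dimensional Banach space is polyhedral if the closed unit ball of each of its finite dimensional subspaces has finitely many extreme points. *)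

theory Defs
  imports "HOL-Analysis.Analysis"
begin

definition norm_on :: "'b::real_vector set \<Rightarrow> ('b \<Rightarrow> real) \<Rightarrow> bool" where
  "norm_on W N \<longleftrightarrow> subspace W \<and>
     (\<forall>x\<in>W. N x \<ge> 0 \<and> (N x = 0 \<longleftrightarrow> x = 0)) \<and>
     (\<forall>x\<in>W. \<forall>c. N (c *\<^sub>R x) = \<bar>c\<bar> * N x) \<and>
     (\<forall>x\<in>W. \<forall>y\<in>W. N (x + y) \<le> N x + N y)"

definition banach_on :: "'b::real_vector set \<Rightarrow> ('b \<Rightarrow> real) \<Rightarrow> bool" where
  "banach_on W N \<longleftrightarrow> norm_on W N \<and>
     (\<forall>s::nat \<Rightarrow> 'b. (\<forall>n. s n \<in> W) \<and>
         (\<forall>e>0. \<exists>M. \<forall>m\<ge>M. \<forall>n\<ge>M. N (s m - s n) < e)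
       \<longrightarrow> (\<exists>l\<in>W. (\<lambda>n. N (s n - l)) \<longlonglongrightarrow> 0))"

definition separable_on :: "'b::real_vector set \<Rightarrow> ('b \<Rightarrow> real) \<Rightarrow> bool" where
  "separable_on W N \<longleftrightarrow> (\<exists>D\<subseteq>W. countable D \<and> (\<forall>x\<in>W. \<forall>e>0. \<exists>d\<in>D. N (x - d) < e))"

definition polyhedral_on :: "'b::real_vector set \<Rightarrow> ('b \<Rightarrow> real) \<Rightarrow> bool" where
  "polyhedral_on W N \<longleftrightarrow>
     \<not> (\<exists>B. finite B \<and> W = span B) \<and>
     (\<forall>F. subspace F \<and> F \<subseteq> W \<and> (\<exists>B. finite B \<and> F = span B) \<longrightarrow>
          finite {x. x extreme_point_of {y\<in>F. N y \<le> 1}})"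

definition isomorphic_on ::
  "'a::real_normed_vector set \<Rightarrow> 'b::real_vector set \<Rightarrow> ('b \<Rightarrow> real) \<Rightarrow> bool" where
  "isomorphic_on V W N \<longleftrightarrow> (\<exists>T. bij_betw T V W \<and>
     (\<forall>x\<in>V. \<forall>y\<in>V. T (x + y) = T x + T y) \<and>
     (\<forall>x\<in>V. \<forall>c. T (c *\<^sub>R x) = c *\<^sub>R T x) \<and>
     (\<exists>a>0. \<exists>b>0. \<forall>x\<in>V. a * norm x \<le> N (T x) \<and> N (T x) \<le> b * norm x))"

text \<open>DSC(K), with K the whole (compact) space: f is the pointwise limit of a uniformly
  bounded sequence of continuous functions whose successive differences are
  pointwise absolutely summable.\<close>
definition DSC :: "('a::topological_space \<Rightarrow> real) set" where
  "DSC = {f. \<exists>fs :: nat \<Rightarrow> ('a \<Rightarrow>\<^sub>C real).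
      (\<exists>B. \<forall>n. norm (fs n) \<le> B) \<and>
      (\<forall>k. (\<lambda>n. apply_bcontfun (fs n) k) \<longlonglongrightarrow> f k) \<and>
      (\<forall>k. summable (\<lambda>n. \<bar>apply_bcontfun (fs (Suc n)) k - apply_bcontfun (fs n) k\<bar>))}"

definition convex_block_seq :: "(nat \<Rightarrow> 'b::real_vector) \<Rightarrow> (nat \<Rightarrow> 'b) \<Rightarrow> bool" where
  "convex_block_seq g fs \<longleftrightarrow> (\<exists>(F :: nat \<Rightarrow> nat set) (c :: nat \<Rightarrow> real).
      (\<forall>n. finite (F n) \<and> F n \<noteq> {}) \<and>
      (\<forall>n. \<forall>i\<in>F n. \<forall>j\<in>F (Suc n). i < j) \<and>
      (\<forall>i. c i \<ge> 0) \<and>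
      (\<forall>n. sum c (F n) = 1) \<and>
      (\<forall>n. g n = (\<Sum>i\<in>F n. c i *\<^sub>R fs i)))"

end

theory Submission
  imports Defs
begin

text \<open>Let \<open>h\<^sub>n\<close> witness \<open>f \<in> DSC\<close>. Since \<open>f\<^sub>n - h\<^sub>n\<close> tends to \<open>0\<close> pointwise, far out convex blocks
  of it are small in norm, so the blocks \<open>g\<^sub>n\<close> of \<open>f\<^sub>n\<close> inherit from \<open>h\<^sub>n\<close> the pointwise absolute summability
  of their differences \<open>d\<^sub>n\<close>. Because \<open>f\<close> has positive distance from \<open>C(K)\<close>, the blocks can be chosen
  so sparse that \<open>(d\<^sub>n)\<close> is a seminormalized basic sequence; in particular the coefficients of every
  vector tend to \<open>0\<close>.

  The closed span is then renormed by the supremum of \<open>w(n, q) \<bar>(P\<^sub>n x)(q)\<bar>\<close>, where \<open>P\<^sub>n\<close> are the basis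
  projections, \<open>q\<close> ranges over a finite net of \<open>K\<close> depending on \<open>n\<close>, and the weight \<open>w(n, q)\<close> decreases
  strictly in the mass \<open>\<Sum>i\<le>n. \<bar>d\<^sub>i(q)\<bar>\<close>. Near a vector \<open>x \<noteq> 0\<close> only finitely many \<open>n\<close> contribute:
  otherwise a limit point \<open>k\<close> of the relevant \<open>q\<close> would carry the whole norm, whereas a truncation at
  \<open>k\<close> gains more weight than it loses value. Hence on every finite-dimensional subspace the norm
  is a maximum of finitely many functionals.\<close>

section \<open>Convex combinations of a pointwise null sequence\<close>

instance bcontfun :: (metric_space, banach) banach ..

lemma bounded_linear_apply_bcontfun:
  "bounded_linear (\<lambda>u :: 'a::topological_space \<Rightarrow>\<^sub>C real. apply_bcontfun u k)"
  by (rule bounded_linear_intro[where K = 1])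
    (use norm_bounded[where 'b = real] in auto)

lemmas apply_bcontfun_sum = linear_sum[OF bounded_linear.linear[OF bounded_linear_apply_bcontfun]]
lemmas tendsto_apply_bcontfun = bounded_linear.tendsto[OF bounded_linear_apply_bcontfun]
lemmas sums_apply_bcontfun = bounded_linear.sums[OF bounded_linear_apply_bcontfun]

lemma convex_abs_apply_le: "convex {w :: 'a::topological_space \<Rightarrow>\<^sub>C real. \<bar>apply_bcontfun w k\<bar> \<le> e}"
proof -
  have "{w :: 'a \<Rightarrow>\<^sub>C real. \<bar>apply_bcontfun w k\<bar> \<le> e} = (\<lambda>w. apply_bcontfun w k) -` cball 0 e"
    by auto
  then show ?thesis
    by (simp add: convex_linear_vimage bounded_linear.linear[OF bounded_linear_apply_bcontfun])
qed

lemma closed_abs_apply_le: "closed {w :: 'a::topological_space \<Rightarrow>\<^sub>C real. \<bar>apply_bcontfun w k\<bar> \<le> e}"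
  by (intro closed_Collect_le continuous_intros
      bounded_linear.continuous_on[OF bounded_linear_apply_bcontfun])

text \<open>This is Simons' inequality in the case of a pointwise null sequence. It replaces the Riesz
  representation theorem and Mazur's lemma: near-optimal points of the hulls are glued into one
  infinite convex combination, and the inequality is read off at a point where that combination
  attains its norm.\<close>

lemma convex_hull_tail_small_norm:
  fixes u :: "nat \<Rightarrow> 'a::metric_space \<Rightarrow>\<^sub>C real"
  assumes K: "compact (UNIV :: 'a set)"
    and bd: "\<And>n. norm (u n) \<le> B"
    and lim: "\<And>k. (\<lambda>n. apply_bcontfun (u n) k) \<longlonglongrightarrow> 0"
    and \<epsilon>: "0 < \<epsilon>"
  shows "\<exists>v \<in> convex hull (u ` {I..}). norm v < \<epsilon>"
proof -
  define C where "C n = convex hull (u ` {I + n..})" for n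
  have C_nonempty: "C n \<noteq> {}" for n
    by (auto simp: C_def)
  have C_mono: "C m \<subseteq> C n" if "n \<le> m" for m n
    unfolding C_def using that by (intro hull_mono) auto
  have C_bound: "norm w \<le> B" if "w \<in> C n" for w n
  proof -
    have "C n \<subseteq> cball 0 B"
      unfolding C_def using bd by (intro hull_minimal) auto
    with that show ?thesis by auto
  qed
  have C_convex: "convex (C n)" for n
    by (simp add: C_def)
  \<comment> \<open>The tolerance has to beat the weight \<open>(1/2)^n\<close> of the unfinished
    combination: after division by it the errors are \<open>\<epsilon> / 8 * (1/2)^n\<close>, with
    total \<open>\<epsilon> / 4\<close>.\<close>
  define \<delta> where "\<delta> n = \<epsilon> / 8 * (1/4) ^ n" for n :: nat
  have \<delta>_pos: "0 < \<delta> n" for n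
    using \<epsilon> by (simp add: \<delta>_def)
  \<comment> \<open>The point \<open>y\<close> is chosen as if the whole remaining weight
    \<open>(1/2)^n\<close> went to it; only half of that is then spent on it in
    \<open>z (Suc n)\<close>.\<close>
  have "\<exists>y\<in>C n. \<forall>w\<in>C n. norm (z + (1/2)^n *\<^sub>R y) \<le> norm (z + (1/2)^n *\<^sub>R w) + \<delta> n" for n z
  proof -
    let ?S = "(\<lambda>w. norm (z + (1/2)^n *\<^sub>R w)) ` C n"
    have S: "?S \<noteq> {}" "bdd_below ?S"
      using C_nonempty by (auto intro!: bdd_belowI[of _ 0])
    have "Inf ?S < Inf ?S + \<delta> n"
      using \<delta>_pos by simp
    from cInf_lessD[OF S(1) this] obtain y where "y \<in> C n" and y: "norm (z + (1/2)^n *\<^sub>R y) < Inf ?S + \<delta> n"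
      by blast
    have "Inf ?S \<le> norm (z + (1/2)^n *\<^sub>R w)" if "w \<in> C n" for w
      using that S(2) by (intro cInf_lower) auto
    with \<open>y \<in> C n\<close> y show ?thesis
      by (force intro!: bexI[of _ y])
  qed
  then obtain Y where Y_in: "\<And>n z. Y n z \<in> C n"
    and Y_min: "\<And>n z w. w \<in> C n \<Longrightarrow> norm (z + (1/2)^n *\<^sub>R Y n z) \<le> norm (z + (1/2)^n *\<^sub>R w) + \<delta> n"
    by metis
  define z where "z = rec_nat 0 (\<lambda>n z. z + (1/2)^Suc n *\<^sub>R Y n z)"
  define y where "y n = Y n (z n)" for n
  have z_Suc: "z (Suc n) = z n + (1/2)^Suc n *\<^sub>R y n" and z_0: "z 0 = 0" for n
    by (simp_all add: z_def y_def)
  have y_in: "y m \<in> C n" if "n \<le> m" for m n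
    using C_mono[OF that] Y_in by (auto simp: y_def)
  have y_min_closure: "norm (z n + (1/2)^n *\<^sub>R y n) \<le> norm (z n + (1/2)^n *\<^sub>R w) + \<delta> n"
    if "w \<in> closure (C n)" for n w
  proof -
    let ?T = "{w. norm (z n + (1/2)^n *\<^sub>R y n) \<le> norm (z n + (1/2)^n *\<^sub>R w) + \<delta> n}"
    have "closed ?T"
      by (intro closed_Collect_le continuous_intros)
    then have "closure (C n) \<subseteq> ?T"
      using Y_min by (intro closure_minimal) (auto simp: y_def)
    with that show ?thesis by auto
  qed
  define t where "t n = (\<Sum>j. (1/2)^Suc j *\<^sub>R y (n + j))" for n
  have summ: "summable (\<lambda>j. (1/2)^Suc j *\<^sub>R y (n + j))" for n
  proof (rule summable_comparison_test')
    show "summable (\<lambda>j. (1/2::real)^Suc j * B)"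
      by (intro summable_mult2) (simp add: summable_mult)
    show "norm ((1/2)^Suc j *\<^sub>R y (n + j)) \<le> (1/2)^Suc j * B" for j
      using C_bound[OF y_in[of n "n + j"]] by (simp add: mult_left_mono)
  qed
  have t_rec: "t n = (1/2) *\<^sub>R y n + (1/2) *\<^sub>R t (Suc n)" for n
  proof -
    have "t n = (\<Sum>j. (1/2)^Suc (Suc j) *\<^sub>R y (n + Suc j)) + (1/2) *\<^sub>R y n"
      using suminf_split_head[OF summ, of n] by (simp add: t_def)
    also have "(\<Sum>j. (1/2)^Suc (Suc j) *\<^sub>R y (n + Suc j)) = (1/2) *\<^sub>R t (Suc n)"
      using suminf_scaleR_right[OF summ[of "Suc n"], of "1/2"] by (simp add: t_def)
    finally show ?thesis by simp
  qed
  have t_total: "t 0 = z n + (1/2)^n *\<^sub>R t n" for n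
  proof (induction n)
    case (Suc n)
    then show ?case
      by (subst (asm) t_rec[of n]) (simp add: z_Suc scaleR_add_right mult.commute)
  qed (simp add: z_0)
  have t_in: "t n \<in> closure (C n)" for n
  proof -
    \<comment> \<open>The unspent weight \<open>(1/2)^N\<close> is put on a further point of
      \<open>C n\<close>, so that the truncated series are true convex combinations.\<close>
    have fin: "(\<Sum>j<N. (1/2)^Suc j *\<^sub>R y (n + j)) + (1/2)^N *\<^sub>R w \<in> C n" if "w \<in> C n" for N w
      using that
    proof (induction N arbitrary: w)
      case (Suc N)
      have "(1/2) *\<^sub>R y (n + N) + (1/2) *\<^sub>R w \<in> C n"
        using C_convex Suc.prems y_in by (intro convexD) auto
      from Suc.IH[OF this] show ?case
        by (simp add: scaleR_add_right mult.commute add.assoc)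
    qed simp
    have "(\<lambda>N. (\<Sum>j<N. (1/2)^Suc j *\<^sub>R y (n + j)) + (1/2)^N *\<^sub>R y n) \<longlonglongrightarrow> t n + 0 *\<^sub>R y n"
      unfolding t_def
      by (intro tendsto_intros summable_LIMSEQ summ LIMSEQ_power_zero) simp
    then show ?thesis
      using fin[OF y_in] by (intro closure_sequential[THEN iffD2] exI conjI) auto
  qed
  obtain k where k: "\<And>k'. \<bar>apply_bcontfun (t 0) k'\<bar> \<le> \<bar>apply_bcontfun (t 0) k\<bar>"
    using continuous_attains_sup[OF K, of "\<lambda>k. \<bar>apply_bcontfun (t 0) k\<bar>"]
    by (auto intro!: continuous_intros)
  define \<sigma> where "\<sigma> = (if apply_bcontfun (t 0) k \<ge> 0 then 1 else - 1 :: real)"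
  have norm_t: "norm (t 0) \<le> \<sigma> * apply_bcontfun (t 0) k"
  proof (rule norm_bound)
    show "norm (apply_bcontfun (t 0) k') \<le> \<sigma> * apply_bcontfun (t 0) k" for k'
      using k[of k'] by (cases "apply_bcontfun (t 0) k \<ge> 0") (simp_all add: \<sigma>_def)
  qed
  have \<sigma>_le: "\<sigma> * apply_bcontfun w k \<le> norm w" for w
    using norm_bounded[of w k] by (auto simp: \<sigma>_def)
  define a where "a n = \<sigma> * apply_bcontfun (t n) k" for n
  \<comment> \<open>As \<open>y n = 2 *\<^sub>R t n - t (Suc n)\<close>, near-minimality against the
    competitor \<open>t n\<close> says that adding
    \<open>(1/2)^n *\<^sub>R (t n - t (Suc n))\<close> to \<open>t 0\<close> hardly raises its norm.
    Read at \<open>k\<close>, where \<open>t 0\<close> attains its norm, this keeps \<open>a\<close>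
    from dropping.\<close>
  have a_step: "a (Suc n) \<ge> a n - \<epsilon> / 8 * (1/2)^n" for n
  proof -
    have y: "y n = 2 *\<^sub>R t n - t (Suc n)"
      by (subst t_rec) (simp add: scaleR_add_right)
    have "z n + (1/2)^n *\<^sub>R y n = t 0 + (1/2)^n *\<^sub>R (t n - t (Suc n))"
      using t_total[of n] by (simp add: y algebra_simps scaleR_2)
    with y_min_closure[OF t_in, of n] t_total[of n]
    have "norm (t 0 + (1/2)^n *\<^sub>R (t n - t (Suc n))) \<le> norm (t 0) + \<delta> n"
      by simp
    with \<sigma>_le[of "t 0 + (1/2)^n *\<^sub>R (t n - t (Suc n))"] norm_t
    have "(1/2)^n * (a n - a (Suc n)) \<le> \<delta> n"
      by (simp add: a_def algebra_simps)
    then have "2^n * ((1/2)^n * (a n - a (Suc n))) \<le> 2^n * \<delta> n"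
      by (intro mult_left_mono) auto
    moreover have "2^n * \<delta> n = \<epsilon> / 8 * (1/2)^n"
      by (simp add: \<delta>_def power_divide field_simps flip: power_mult_distrib)
    ultimately show ?thesis
      by (simp add: power_divide)
  qed
  have a_lower: "a n \<ge> norm (t 0) - \<epsilon> / 4 * (1 - (1/2)^n)" for n
  proof (induction n)
    case 0
    then show ?case using norm_t by (simp add: a_def)
  next
    case (Suc n)
    with a_step[of n] show ?case by (simp add: algebra_simps)
  qed
  \<comment> \<open>Pointwise convergence is used at the single point \<open>k\<close>: it bounds
    \<open>a n\<close> above by \<open>\<epsilon> / 4\<close>, whereas \<open>a_lower\<close> keeps
    \<open>a n\<close> at least \<open>norm (t 0) - \<epsilon> / 4\<close>.\<close>
  obtain n where n: "\<And>i. i \<ge> n \<Longrightarrow> \<bar>apply_bcontfun (u i) k\<bar> \<le> \<epsilon> / 4"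
    using lim[of k] \<epsilon> unfolding LIMSEQ_def
    by (metis dist_real_def diff_zero less_imp_le zero_less_divide_iff zero_less_numeral)
  have "closure (C n) \<subseteq> {w. \<bar>apply_bcontfun w k\<bar> \<le> \<epsilon> / 4}"
    unfolding C_def using n
    by (intro closure_minimal hull_minimal closed_abs_apply_le convex_abs_apply_le) auto
  with t_in[of n] have "a n \<le> \<epsilon> / 4"
    by (auto simp: a_def \<sigma>_def abs_le_iff)
  moreover have "\<epsilon> / 4 * (1 - (1/2)^n) \<le> \<epsilon> / 4"
    using \<epsilon> by (simp add: algebra_simps)
  ultimately have small: "norm (t 0) < \<epsilon>"
    using a_lower[of n] \<epsilon> by linarith
  then obtain v where "v \<in> C 0" "dist v (t 0) < \<epsilon> - norm (t 0)"
    using t_in[of 0] unfolding closure_approachable by (metis diff_gt_0_iff_gt)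
  then have "norm v < \<epsilon>"
    using norm_triangle_ineq[of "v - t 0" "t 0"] by (simp add: dist_norm)
  with \<open>v \<in> C 0\<close> show ?thesis
    by (auto simp: C_def)
qed

section \<open>Schauder coefficients\<close>

text \<open>\<open>proj_bound\<close> is Grunblum's criterion for a basic sequence;
  \<open>coeff_bound\<close> moreover forces \<open>1 \<le> C * norm (d n)\<close>, so the
  \<open>d n\<close> stay away from \<open>0\<close>. One constant serves both.\<close>

locale basic_sequence =
  fixes d :: "nat \<Rightarrow> 'b::banach" and C :: real
  assumes coeff_bound: "n \<le> m \<Longrightarrow> \<bar>\<alpha> n\<bar> \<le> C * norm (\<Sum>i\<le>m. \<alpha> i *\<^sub>R d i)"
    and proj_bound: "n \<le> m \<Longrightarrow> norm (\<Sum>i\<le>n. \<alpha> i *\<^sub>R d i) \<le> C * norm (\<Sum>i\<le>m. \<alpha> i *\<^sub>R d i)"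
begin

definition W :: "'b set" where "W = closure (span (range d))"

text \<open>On \<open>W\<close> the expansion exists and is unique; elsewhere the value is
  arbitrary, hence the assumptions \<open>x \<in> W\<close> below.\<close>

definition coeff :: "'b \<Rightarrow> nat \<Rightarrow> real" where
  "coeff x = (SOME \<alpha>. (\<lambda>i. \<alpha> i *\<^sub>R d i) sums x)"

definition proj :: "nat \<Rightarrow> 'b \<Rightarrow> 'b" where
  "proj n x = (\<Sum>i\<le>n. coeff x i *\<^sub>R d i)"

lemma C_pos: "0 < C"
proof -
  have "1 \<le> C * norm (\<Sum>i\<le>0. 1 *\<^sub>R d i)"
    using coeff_bound[of 0 0 "\<lambda>_. 1"] by simp
  then have "0 < C * norm (d 0)" by simp
  then show ?thesis
    by (simp add: zero_less_mult_iff)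
qed

lemma sums_coeff_bound:
  assumes "(\<lambda>i. \<alpha> i *\<^sub>R d i) sums x"
  shows "\<bar>\<alpha> n\<bar> \<le> C * norm x"
proof -
  have "(\<lambda>m. C * norm (\<Sum>i\<le>m. \<alpha> i *\<^sub>R d i)) \<longlonglongrightarrow> C * norm x"
    using assms unfolding sums_def_le by (intro tendsto_intros)
  then show ?thesis
    by (rule LIMSEQ_le_const) (use coeff_bound in blast)
qed

lemma sums_proj_bound:
  assumes "(\<lambda>i. \<alpha> i *\<^sub>R d i) sums x"
  shows "norm (\<Sum>i\<le>n. \<alpha> i *\<^sub>R d i) \<le> C * norm x"
proof -
  have "(\<lambda>m. C * norm (\<Sum>i\<le>m. \<alpha> i *\<^sub>R d i)) \<longlonglongrightarrow> C * norm x"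
    using assms unfolding sums_def_le by (intro tendsto_intros)
  then show ?thesis
    by (rule LIMSEQ_le_const) (use proj_bound in blast)
qed

lemma sums_unique_coeff:
  assumes "(\<lambda>i. \<alpha> i *\<^sub>R d i) sums x" "(\<lambda>i. \<beta> i *\<^sub>R d i) sums x"
  shows "\<alpha> = \<beta>"
proof
  fix n
  have "(\<lambda>i. (\<alpha> i - \<beta> i) *\<^sub>R d i) sums 0"
    using sums_diff[OF assms] by (simp add: scaleR_diff_left)
  from sums_coeff_bound[OF this, of n] show "\<alpha> n = \<beta> n" by simp
qed

lemma coeff_eq: "(\<lambda>i. \<alpha> i *\<^sub>R d i) sums x \<Longrightarrow> coeff x = \<alpha>"
  unfolding coeff_def by (rule some_equality) (auto intro: sums_unique_coeff)

lemma sums_finite_coeff: "(\<lambda>i. (if i = n then 1 else 0) *\<^sub>R d i) sums d n"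
proof -
  have "(\<lambda>i. (if i = n then 1 else 0) *\<^sub>R d i) = (\<lambda>i. if i = n then d i else 0)"
    by auto
  then show ?thesis using sums_single[of n d] by simp
qed

lemma subspace_sums: "subspace {x. \<exists>\<alpha>. (\<lambda>i. \<alpha> i *\<^sub>R d i) sums x}"
proof (rule subspaceI; safe?)
  show "\<exists>\<alpha>. (\<lambda>i. \<alpha> i *\<^sub>R d i) sums 0"
    by (rule exI[of _ "\<lambda>_. 0"]) simp
next
  fix x y \<alpha> \<beta>
  assume "(\<lambda>i. \<alpha> i *\<^sub>R d i) sums x" "(\<lambda>i. \<beta> i *\<^sub>R d i) sums y"
  from sums_add[OF this] show "\<exists>\<gamma>. (\<lambda>i. \<gamma> i *\<^sub>R d i) sums (x + y)"
    by (intro exI[of _ "\<lambda>i. \<alpha> i + \<beta> i"]) (simp add: scaleR_add_left)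
next
  fix c :: real and x \<alpha>
  assume "(\<lambda>i. \<alpha> i *\<^sub>R d i) sums x"
  from sums_scaleR_right[OF this, of c] show "\<exists>\<gamma>. (\<lambda>i. \<gamma> i *\<^sub>R d i) sums (c *\<^sub>R x)"
    by (intro exI[of _ "\<lambda>i. c * \<alpha> i"]) simp
qed

text \<open>The coefficients of a convergent sequence of expansions are Cauchy, and the bound on
  partial sums, uniform in their length, allows the two limits to be interchanged.\<close>

lemma closed_sums: "closed {x. \<exists>\<alpha>. (\<lambda>i. \<alpha> i *\<^sub>R d i) sums x}"
  unfolding closed_sequential_limits
proof safe
  fix X :: "nat \<Rightarrow> 'b" and x
  assume "\<forall>j. X j \<in> {x. \<exists>\<alpha>. (\<lambda>i. \<alpha> i *\<^sub>R d i) sums x}" and X: "X \<longlonglongrightarrow> x"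
  then obtain \<alpha> where \<alpha>: "\<And>j. (\<lambda>i. \<alpha> j i *\<^sub>R d i) sums X j"
    by simp metis
  have diff: "(\<lambda>i. (\<alpha> j i - \<alpha> l i) *\<^sub>R d i) sums (X j - X l)" for j l
    using sums_diff[OF \<alpha>[of j] \<alpha>[of l]] by (simp add: scaleR_diff_left)
  have "Cauchy (\<lambda>j. \<alpha> j i)" for i
  proof (rule metric_CauchyI)
    fix e :: real assume "0 < e"
    then obtain M where M: "\<And>j l. j \<ge> M \<Longrightarrow> l \<ge> M \<Longrightarrow> dist (X j) (X l) < e / C"
      using LIMSEQ_imp_Cauchy[OF X] C_pos unfolding Cauchy_def
      by (metis divide_pos_pos)
    have "dist (\<alpha> j i) (\<alpha> l i) < e" if "j \<ge> M" "l \<ge> M" for j l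
      using sums_coeff_bound[OF diff[of j l], of i] M[OF that] C_pos
      by (auto simp: dist_norm field_simps)
    then show "\<exists>M. \<forall>m\<ge>M. \<forall>n\<ge>M. dist (\<alpha> m i) (\<alpha> n i) < e" by blast
  qed
  then obtain a where a: "\<And>i. (\<lambda>j. \<alpha> j i) \<longlonglongrightarrow> a i"
    unfolding Cauchy_convergent_iff convergent_def by metis
  \<comment> \<open>Letting \<open>l\<close> tend to infinity at fixed \<open>n\<close> leaves a
    bound free of \<open>n\<close>, so that \<open>j\<close> can be fixed before \<open>n\<close> in
    the convergence proof below.\<close>
  have part: "norm (\<Sum>i\<le>n. (\<alpha> j i - a i) *\<^sub>R d i) \<le> C * norm (X j - x)" for n j
  proof (rule LIMSEQ_le)
    show "(\<lambda>l. norm (\<Sum>i\<le>n. (\<alpha> j i - \<alpha> l i) *\<^sub>R d i)) \<longlonglongrightarrow> norm (\<Sum>i\<le>n. (\<alpha> j i - a i) *\<^sub>R d i)"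
      by (intro tendsto_intros a)
    show "(\<lambda>l. C * norm (X j - X l)) \<longlonglongrightarrow> C * norm (X j - x)"
      by (intro tendsto_intros X)
  qed (use sums_proj_bound[OF diff] in blast)
  have "(\<lambda>n. \<Sum>i\<le>n. a i *\<^sub>R d i) \<longlonglongrightarrow> x"
  proof (rule LIMSEQ_I)
    fix e :: real assume e: "0 < e"
    have "(\<lambda>j. (C + 1) * norm (X j - x)) \<longlonglongrightarrow> (C + 1) * norm (x - x)"
      by (intro tendsto_intros X)
    then have "\<forall>\<^sub>F j in sequentially. (C + 1) * norm (X j - x) < e / 2"
      by (rule order_tendstoD) (use e in simp)
    then obtain j where j: "(C + 1) * norm (X j - x) < e / 2"
      by (auto simp: eventually_sequentially)
    obtain M where M: "\<And>n. n \<ge> M \<Longrightarrow> norm ((\<Sum>i\<le>n. \<alpha> j i *\<^sub>R d i) - X j) < e / 2"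
      using LIMSEQ_D[OF \<alpha>[of j, unfolded sums_def_le], of "e / 2"] e by auto
    have "norm ((\<Sum>i\<le>n. a i *\<^sub>R d i) - x) < e" if "n \<ge> M" for n
    proof -
      have "(\<Sum>i\<le>n. a i *\<^sub>R d i) - x = ((\<Sum>i\<le>n. \<alpha> j i *\<^sub>R d i) - X j) + (X j - x)
          - (\<Sum>i\<le>n. (\<alpha> j i - a i) *\<^sub>R d i)"
        by (simp add: scaleR_diff_left sum_subtractf)
      also have "norm \<dots> \<le> norm ((\<Sum>i\<le>n. \<alpha> j i *\<^sub>R d i) - X j) + norm (X j - x)
          + norm (\<Sum>i\<le>n. (\<alpha> j i - a i) *\<^sub>R d i)"
        by (rule order_trans[OF norm_triangle_ineq4 add_right_mono[OF norm_triangle_ineq]])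
      finally show ?thesis
        using M[OF that] part[of j n] j by (simp add: distrib_right)
    qed
    then show "\<exists>no. \<forall>n\<ge>no. norm ((\<Sum>i\<le>n. a i *\<^sub>R d i) - x) < e" by blast
  qed
  then show "\<exists>\<alpha>. (\<lambda>i. \<alpha> i *\<^sub>R d i) sums x"
    by (auto simp: sums_def_le)
qed

lemma W_eq: "W = {x. \<exists>\<alpha>. (\<lambda>i. \<alpha> i *\<^sub>R d i) sums x}" (is "W = ?S")
proof
  have "range d \<subseteq> ?S"
    using sums_finite_coeff by (simp add: image_subset_iff) fast
  then show "W \<subseteq> ?S"
    unfolding W_def by (intro closure_minimal span_minimal subspace_sums closed_sums)
  show "?S \<subseteq> W"
  proof safe
    fix x \<alpha> assume "(\<lambda>i. \<alpha> i *\<^sub>R d i) sums x"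
    moreover have "(\<Sum>i\<le>n. \<alpha> i *\<^sub>R d i) \<in> span (range d)" for n
      by (intro span_sum span_scale span_base) simp
    ultimately show "x \<in> W"
      unfolding W_def closure_sequential sums_def_le
      by (intro exI[of _ "\<lambda>n. \<Sum>i\<le>n. \<alpha> i *\<^sub>R d i"]) auto
  qed
qed

lemma coeff_sums: "x \<in> W \<Longrightarrow> (\<lambda>i. coeff x i *\<^sub>R d i) sums x"
  using coeff_eq by (fastforce simp: W_eq)

lemma subspace_W: "subspace W"
  unfolding W_eq by (rule subspace_sums)

lemma closed_W: "closed W"
  by (simp add: W_def)

lemma d_in_W: "d n \<in> W"
  using closure_subset span_superset by (fastforce simp: W_def)

lemma coeff_d: "coeff (d n) i = (if i = n then 1 else 0)"
  using coeff_eq[OF sums_finite_coeff] by simp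

lemma coeff_add:
  assumes "x \<in> W" "y \<in> W"
  shows "coeff (x + y) i = coeff x i + coeff y i"
  using coeff_eq[of "\<lambda>i. coeff x i + coeff y i" "x + y"] sums_add[OF assms[THEN coeff_sums]]
  by (simp add: scaleR_add_left)

lemma coeff_scaleR:
  assumes "x \<in> W"
  shows "coeff (c *\<^sub>R x) i = c * coeff x i"
  using coeff_eq[of "\<lambda>i. c * coeff x i" "c *\<^sub>R x"]
    sums_scaleR_right[OF coeff_sums[OF assms], of c]
  by simp

lemma proj_add: "x \<in> W \<Longrightarrow> y \<in> W \<Longrightarrow> proj n (x + y) = proj n x + proj n y"
  by (simp add: proj_def coeff_add scaleR_add_left sum.distrib)

lemma proj_scaleR: "x \<in> W \<Longrightarrow> proj n (c *\<^sub>R x) = c *\<^sub>R proj n x"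
  by (simp add: proj_def coeff_scaleR scaleR_sum_right)

lemma proj_diff:
  assumes "x \<in> W" "y \<in> W"
  shows "proj n (x - y) = proj n x - proj n y"
proof -
  have "proj n (x + (- 1) *\<^sub>R y) = proj n x + (- 1) *\<^sub>R proj n y"
    using assms subspace_scale[OF subspace_W] by (metis proj_add proj_scaleR)
  then show ?thesis by simp
qed

lemma norm_proj_le: "x \<in> W \<Longrightarrow> norm (proj n x) \<le> C * norm x"
  unfolding proj_def by (intro sums_proj_bound coeff_sums)

lemma abs_coeff_le: "x \<in> W \<Longrightarrow> \<bar>coeff x n\<bar> \<le> C * norm x"
  by (intro sums_coeff_bound coeff_sums)

lemma proj_tendsto: "x \<in> W \<Longrightarrow> (\<lambda>n. proj n x) \<longlonglongrightarrow> x"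
  using coeff_sums by (simp add: sums_def_le proj_def)

text \<open>The terms of a convergent series tend to \<open>0\<close>, and the \<open>d i\<close>
  are bounded away from \<open>0\<close> in norm. Truncating far out therefore loses arbitrarily
  little per unit of mass.\<close>

lemma coeff_tendsto_0:
  assumes "x \<in> W"
  shows "coeff x \<longlonglongrightarrow> 0"
proof -
  have "1 \<le> C * norm (d i)" for i
    using abs_coeff_le[OF d_in_W[of i], of i] by (simp add: coeff_d)
  then have "norm (coeff x i) \<le> C * norm (coeff x i *\<^sub>R d i)" for i
    using mult_left_mono[of 1 "C * norm (d i)" "\<bar>coeff x i\<bar>"] by (simp add: algebra_simps)
  moreover have "(\<lambda>i. C * norm (coeff x i *\<^sub>R d i)) \<longlonglongrightarrow> C * 0"
    using summable_LIMSEQ_zero[OF sums_summable[OF coeff_sums[OF assms]]]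
    by (intro tendsto_mult tendsto_const tendsto_norm_zero)
  ultimately show ?thesis
    by (intro Lim_null_comparison[where f = "coeff x"]) auto
qed

section \<open>Infinite dimension and separability of \<open>W\<close>\<close>

lemma infinite_dimensional: "\<not> (\<exists>B. finite B \<and> W = span B)"
proof
  assume "\<exists>B. finite B \<and> W = span B"
  then obtain B where B: "finite B" "W = span B" by blast
  have inj: "inj d"
  proof (rule injI)
    fix m n assume "d m = d n"
    then have "coeff (d m) m = coeff (d n) m" by simp
    then show "m = n" by (simp add: coeff_d split: if_splits)
  qed
  \<comment> \<open>The \<open>n\<close>-th coordinate functional vanishes on every other
    \<open>d i\<close> but not on \<open>d n\<close>.\<close>
  have "d n \<notin> span (range d - {d n})" for n
  proof -
    have "subspace {x \<in> W. coeff x n = 0}"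
      using subspace_W coeff_eq[of "\<lambda>_. 0" 0]
      by (auto simp: subspace_def coeff_add coeff_scaleR)
    then have "span (range d - {d n}) \<subseteq> {x \<in> W. coeff x n = 0}"
      by (intro span_minimal) (auto simp: d_in_W coeff_d)
    then show ?thesis by (auto simp: coeff_d)
  qed
  then have "independent (range d)"
    by (auto simp: dependent_def)
  moreover have "range d \<subseteq> span B"
    using d_in_W B(2) by auto
  ultimately have "finite (range d)"
    using independent_span_bound[OF B(1)] by blast
  then show False
    using inj finite_imageD by blast
qed

lemma separable_W: "\<exists>D\<subseteq>W. countable D \<and> (\<forall>x\<in>W. \<forall>e>0. \<exists>y\<in>D. norm (x - y) < e)"
proof -
  define D where "D = (\<lambda>q :: rat list. \<Sum>i<length q. of_rat (q ! i) *\<^sub>R d i) ` UNIV"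
  have D_W: "D \<subseteq> W"
    unfolding D_def
    by (auto intro!: subspace_sum subspace_scale subspace_W d_in_W)
  have "\<exists>y\<in>D. norm (x - y) < e" if "x \<in> W" "0 < e" for x e
  proof -
    obtain n where n: "norm (proj n x - x) < e / 2"
      using proj_tendsto[OF \<open>x \<in> W\<close>] \<open>0 < e\<close>
      by (metis LIMSEQ_D half_gt_zero order_refl)
    \<comment> \<open>Rounding every coefficient up to index \<open>n\<close> to within
      \<open>\<eta>\<close> costs at most \<open>e / 2\<close> in total; the summand
      \<open>1\<close> keeps the denominator positive.\<close>
    define \<eta> where "\<eta> = e / 2 / (1 + (\<Sum>i\<le>n. norm (d i)))"
    have pos: "0 < 1 + (\<Sum>i\<le>n. norm (d i))"
      by (simp add: add_pos_nonneg sum_nonneg)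
    then have "0 < \<eta>"
      using \<open>0 < e\<close> by (simp add: \<eta>_def)
    have "\<exists>r :: rat. \<bar>of_rat r - coeff x i\<bar> < \<eta>" for i
    proof -
      obtain r :: rat where "coeff x i < of_rat r" "of_rat r < coeff x i + \<eta>"
        using of_rat_dense[of "coeff x i" "coeff x i + \<eta>"] \<open>0 < \<eta>\<close> by auto
      then have "\<bar>of_rat r - coeff x i\<bar> < \<eta>" by simp
      then show ?thesis ..
    qed
    then obtain r :: "nat \<Rightarrow> rat" where r: "\<And>i. \<bar>of_rat (r i) - coeff x i\<bar> < \<eta>"
      by metis
    define y where "y = (\<Sum>i\<le>n. of_rat (r i) *\<^sub>R d i)"
    have "y = (\<Sum>i<length (map r [0..<Suc n]). of_rat (map r [0..<Suc n] ! i) *\<^sub>R d i)"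
      unfolding y_def by (intro sum.cong) (auto simp del: upt_Suc)
    then have "y \<in> D"
      unfolding D_def by blast
    have "norm (proj n x - y) \<le> (\<Sum>i\<le>n. norm ((coeff x i - of_rat (r i)) *\<^sub>R d i))"
      unfolding proj_def y_def sum_subtractf[symmetric] scaleR_diff_left[symmetric] by (rule norm_sum)
    also have "\<dots> \<le> (\<Sum>i\<le>n. \<eta> * norm (d i))"
      using r by (intro sum_mono) (auto intro!: mult_right_mono simp: abs_minus_commute less_imp_le)
    also have "\<dots> \<le> \<eta> * (1 + (\<Sum>i\<le>n. norm (d i)))"
      using \<open>0 < \<eta>\<close> by (simp add: sum_distrib_left algebra_simps)
    also have "\<dots> = e / 2"
      using pos by (metis \<eta>_def nonzero_eq_divide_eq less_irrefl)
    finally have "norm (x - y) < e"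
      using n norm_triangle_ineq[of "x - proj n x" "proj n x - y"] by (simp add: norm_minus_commute)
    with \<open>y \<in> D\<close> show ?thesis by blast
  qed
  moreover have "countable D"
    by (simp add: D_def)
  ultimately show ?thesis using D_W by blast
qed

end

section \<open>Finite-dimensional polytopes\<close>

text \<open>Bolzano-Weierstrass by induction on the spanning set: a new vector outside
  \<open>span B\<close> has positive distance from it, which bounds its coefficients in a bounded
  sequence.\<close>

lemma finite_span_bounded_convergent_subseq:
  fixes B :: "'b::real_normed_vector set"
  assumes "finite B" "\<And>n. x n \<in> span B" "\<And>n. norm (x n) \<le> R"
  shows "\<exists>l\<in>span B. \<exists>r. strict_mono (r :: nat \<Rightarrow> nat) \<and> (x \<circ> r) \<longlonglongrightarrow> l"
  using assms
proof (induction B arbitrary: x R rule: finite_induct)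
  case empty
  then have "x = (\<lambda>_. 0)" by auto
  then show ?case
    by (auto intro!: exI[of _ id] simp: strict_mono_id)
next
  case (insert b B)
  show ?case
  proof (cases "b \<in> span B")
    case True
    with insert.IH[of x R] insert.prems show ?thesis
      by (simp add: span_redundant)
  next
    case False
    \<comment> \<open>Otherwise \<open>b\<close> is a limit of points of \<open>span B\<close>, and
      the induction hypothesis for that bounded sequence puts \<open>b\<close> itself into
      \<open>span B\<close>.\<close>
    have "\<exists>\<delta>>0. \<forall>s\<in>span B. \<delta> \<le> norm (b - s)"
    proof (rule ccontr)
      assume "\<not> ?thesis"
      then have "\<forall>n. \<exists>s\<in>span B. norm (b - s) < 1 / real (Suc n)"
        by (metis not_le of_nat_0_less_iff zero_less_Suc zero_less_divide_1_iff)
      then obtain s where s: "\<And>n. s n \<in> span B" "\<And>n. norm (b - s n) < 1 / real (Suc n)"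
        by metis
      have "norm (s n) \<le> norm b + 1" for n
      proof -
        have "norm (b - s n) \<le> 1"
          using s(2)[of n] by (rule order.trans[OF less_imp_le]) simp
        then show ?thesis
          using norm_triangle_ineq2[of "s n" b] by (simp add: norm_minus_commute)
      qed
      from insert.IH[of s, OF s(1) this] obtain l r
        where l: "l \<in> span B" "strict_mono (r :: nat \<Rightarrow> nat)" "(s \<circ> r) \<longlonglongrightarrow> l"
        by (elim bexE exE conjE) (rule that)
      have "s \<longlonglongrightarrow> b"
      proof (rule LIM_zero_cancel[OF Lim_null_comparison])
        show "\<forall>\<^sub>F n in sequentially. norm (s n - b) \<le> 1 / real (Suc n)"
          using s(2) by (intro always_eventually allI) (simp add: norm_minus_commute less_imp_le del: of_nat_Suc)
        show "(\<lambda>n. 1 / real (Suc n)) \<longlonglongrightarrow> 0"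
          using LIMSEQ_inverse_real_of_nat by (simp add: inverse_eq_divide)
      qed
      with l have "l = b"
        using LIMSEQ_subseq_LIMSEQ LIMSEQ_unique by blast
      with l False show False by simp
    qed
    then obtain \<delta> where \<delta>: "\<delta> > 0" "\<And>s. s \<in> span B \<Longrightarrow> \<delta> \<le> norm (b - s)" by blast
    have "\<exists>t. x n - t *\<^sub>R b \<in> span B" for n
      using insert.prems(1)[of n] by (simp add: span_breakdown_eq)
    then obtain t where t: "\<And>n. x n - t n *\<^sub>R b \<in> span B" by metis
    \<comment> \<open>Dividing \<open>x n\<close> by \<open>t n\<close> exhibits a point of
      \<open>span B\<close> whose distance from \<open>b\<close> is
      \<open>norm (x n) / \<bar>t n\<bar>\<close>.\<close>
    have t_bound: "\<bar>t n\<bar> \<le> R / \<delta>" for n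
    proof (cases "t n = 0")
      case True
      have "0 \<le> R" using insert.prems(2)[of n] norm_ge_zero order_trans by blast
      with True \<delta> show ?thesis by simp
    next
      case False
      have "b - (1 / t n) *\<^sub>R x n = (- (1 / t n)) *\<^sub>R (x n - t n *\<^sub>R b)"
        using False by (simp add: scaleR_diff_right)
      then have "- (1 / t n) *\<^sub>R (x n - t n *\<^sub>R b) \<in> span B"
        by (intro span_scale t)
      from \<delta>(2)[OF this] have "\<delta> \<le> norm ((1 / t n) *\<^sub>R x n)"
        using False by (simp add: scaleR_diff_right)
      also have "\<dots> = norm (x n) / \<bar>t n\<bar>" by simp
      finally have "\<delta> * \<bar>t n\<bar> \<le> norm (x n)"
        using False by (simp add: field_simps)
      also have "\<dots> \<le> R" by (rule insert.prems)
      finally show ?thesis using \<delta>(1) by (simp add: field_simps)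
    qed
    then have "bounded (range t)"
      by (auto simp: bounded_iff)
    from bounded_imp_convergent_subsequence[OF this]
    obtain c r where r: "strict_mono (r :: nat \<Rightarrow> nat)" and c: "(t \<circ> r) \<longlonglongrightarrow> c" by blast
    define s where "s n = x (r n) - t (r n) *\<^sub>R b" for n
    have "norm (s n) \<le> R + R / \<delta> * norm b" for n
    proof -
      have "norm (t (r n) *\<^sub>R b) \<le> R / \<delta> * norm b"
        unfolding norm_scaleR by (intro mult_right_mono t_bound) simp
      then show ?thesis
        unfolding s_def by (intro order_trans[OF norm_triangle_ineq4] add_mono insert.prems)
    qed
    moreover have "s n \<in> span B" for n
      by (simp add: s_def t)
    ultimately obtain l r' where l: "l \<in> span B" "strict_mono (r' :: nat \<Rightarrow> nat)" "(s \<circ> r') \<longlonglongrightarrow> l"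
      using insert.IH[of s] by blast
    have "(\<lambda>n. (s \<circ> r') n + ((t \<circ> r) \<circ> r') n *\<^sub>R b) \<longlonglongrightarrow> l + c *\<^sub>R b"
      by (intro tendsto_intros l LIMSEQ_subseq_LIMSEQ[OF c])
    then have "(x \<circ> (r \<circ> r')) \<longlonglongrightarrow> l + c *\<^sub>R b"
      by (simp add: s_def o_def)
    moreover have "strict_mono (r \<circ> r')"
      using r l(2) by (rule strict_mono_o)
    moreover have "l + c *\<^sub>R b \<in> span (insert b B)"
      using l(1) by (intro span_add span_scale) (auto intro: span_base span_mono[THEN subsetD, of B])
    ultimately show ?thesis by blast
  qed
qed

lemma compact_finite_dim_sphere:
  fixes B :: "'b::real_normed_vector set"
  assumes "finite B"
  shows "compact (span B \<inter> sphere 0 1)"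
  unfolding compact_def
proof safe
  fix x :: "nat \<Rightarrow> 'b" assume x: "\<forall>n. x n \<in> span B \<inter> sphere 0 1"
  then obtain l r where l: "l \<in> span B" "strict_mono (r :: nat \<Rightarrow> nat)" "(x \<circ> r) \<longlonglongrightarrow> l"
    using finite_span_bounded_convergent_subseq[OF assms, of x 1] by auto
  have "(\<lambda>n. norm ((x \<circ> r) n)) \<longlonglongrightarrow> norm l"
    using l(3) by (rule tendsto_norm)
  moreover have "(\<lambda>n. norm ((x \<circ> r) n)) = (\<lambda>_. 1)"
    using x by (auto simp: dist_norm)
  ultimately have "norm l = 1"
    by (simp add: LIMSEQ_const_iff)
  with l show "\<exists>l\<in>span B \<inter> sphere 0 1. \<exists>r. strict_mono r \<and> (x \<circ> r) \<longlonglongrightarrow> l"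
    by (intro bexI[of _ l] exI[of _ r]) auto
qed

text \<open>Two extreme points with the same active constraints coincide: the segment through both can
  be prolonged beyond either of them.\<close>

lemma finite_extreme_points_of_polytope:
  fixes F :: "'b::real_vector set" and \<phi> :: "'i \<Rightarrow> 'b \<Rightarrow> real"
  assumes F: "subspace F" and J: "finite J"
    and add: "\<And>j x y. j \<in> J \<Longrightarrow> x \<in> F \<Longrightarrow> y \<in> F \<Longrightarrow> \<phi> j (x + y) = \<phi> j x + \<phi> j y"
    and scale: "\<And>j c x. j \<in> J \<Longrightarrow> x \<in> F \<Longrightarrow> \<phi> j (c *\<^sub>R x) = c * \<phi> j x"
  shows "finite {x. x extreme_point_of {y\<in>F. \<forall>j\<in>J. \<bar>\<phi> j y\<bar> \<le> 1}}" (is "finite {x. x extreme_point_of ?P}")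
proof -
  \<comment> \<open>The two signs are recorded separately: only then do equal patterns force
    \<open>\<phi> j x = \<phi> j y\<close> at the active constraints.\<close>
  define A where "A x = ({j\<in>J. \<phi> j x = 1}, {j\<in>J. \<phi> j x = - 1})" for x
  have "inj_on A {x. x extreme_point_of ?P}"
  proof (rule inj_onI; safe)
    fix x y assume x: "x extreme_point_of ?P" and y: "y extreme_point_of ?P" and "A x = A y"
    have xP: "x \<in> F" "\<And>j. j \<in> J \<Longrightarrow> \<bar>\<phi> j x\<bar> \<le> 1" and yP: "y \<in> F" "\<And>j. j \<in> J \<Longrightarrow> \<bar>\<phi> j y\<bar> \<le> 1"
      using x y by (auto simp: extreme_point_of_def)
    define v where "v = x - y"
    have v: "v \<in> F"
      using F xP yP by (simp add: v_def subspace_diff)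
    have \<phi>_v: "\<phi> j v = \<phi> j x - \<phi> j y" if "j \<in> J" for j
      using add[OF that xP(1) subspace_scale[OF F yP(1), of "-1"]] scale[OF that yP(1), of "-1"]
      by (simp add: v_def)
    have active: "\<phi> j v = 0" if "j \<in> J" "\<bar>\<phi> j x\<bar> = 1" for j
    proof -
      have "\<phi> j x = 1 \<or> \<phi> j x = - 1" using that(2) by linarith
      moreover have "j \<in> fst (A x) \<longleftrightarrow> j \<in> fst (A y)" "j \<in> snd (A x) \<longleftrightarrow> j \<in> snd (A y)"
        using \<open>A x = A y\<close> by auto
      ultimately show ?thesis
        using that(1) by (auto simp: A_def \<phi>_v)
    qed
    \<comment> \<open>Active constraints do not move along \<open>v\<close>, and each of the
      finitely many others leaves some slack.\<close>
    have "\<exists>\<epsilon>>0. \<forall>j\<in>J. \<bar>\<phi> j x\<bar> + \<epsilon> * \<bar>\<phi> j v\<bar> \<le> 1"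
      using J active xP(2)
    proof (induction J rule: finite_induct)
      case (insert j J)
      then obtain \<epsilon> where \<epsilon>: "\<epsilon> > 0" "\<forall>i\<in>J. \<bar>\<phi> i x\<bar> + \<epsilon> * \<bar>\<phi> i v\<bar> \<le> 1" by auto
      show ?case
      proof (cases "\<bar>\<phi> j x\<bar> = 1")
        case True
        with insert.prems \<epsilon> show ?thesis by (intro exI[of _ \<epsilon>]) auto
      next
        case False
        with insert.prems have lt: "\<bar>\<phi> j x\<bar> < 1" by force
        define \<epsilon>' where "\<epsilon>' = min \<epsilon> ((1 - \<bar>\<phi> j x\<bar>) / (1 + \<bar>\<phi> j v\<bar>))"
        have "\<epsilon>' > 0"
          using \<epsilon>(1) lt by (simp add: \<epsilon>'_def add_pos_nonneg)
        moreover have "\<bar>\<phi> i x\<bar> + \<epsilon>' * \<bar>\<phi> i v\<bar> \<le> 1" if "i \<in> J" for i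
        proof -
          have "\<epsilon>' * \<bar>\<phi> i v\<bar> \<le> \<epsilon> * \<bar>\<phi> i v\<bar>"
            by (intro mult_right_mono) (auto simp: \<epsilon>'_def)
          then show ?thesis using \<epsilon>(2) that by force
        qed
        moreover have "\<bar>\<phi> j x\<bar> + \<epsilon>' * \<bar>\<phi> j v\<bar> \<le> 1"
        proof -
          have "\<epsilon>' * \<bar>\<phi> j v\<bar> \<le> \<epsilon>' * (1 + \<bar>\<phi> j v\<bar>)"
            using \<open>\<epsilon>' > 0\<close> by simp
          also have "\<dots> \<le> (1 - \<bar>\<phi> j x\<bar>) / (1 + \<bar>\<phi> j v\<bar>) * (1 + \<bar>\<phi> j v\<bar>)"
            by (intro mult_right_mono) (auto simp: \<epsilon>'_def)
          also have "\<dots> = 1 - \<bar>\<phi> j x\<bar>"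
            using abs_ge_zero[of "\<phi> j v"] by (simp add: add_nonneg_eq_0_iff)
          finally show ?thesis by simp
        qed
        ultimately show ?thesis by auto
      qed
    qed (auto intro: exI[of _ 1])
    then obtain \<epsilon> where \<epsilon>: "\<epsilon> > 0" "\<And>j. j \<in> J \<Longrightarrow> \<bar>\<phi> j x\<bar> + \<epsilon> * \<bar>\<phi> j v\<bar> \<le> 1" by blast
    have in_P: "x + c *\<^sub>R v \<in> ?P" if "\<bar>c\<bar> \<le> \<epsilon>" for c
    proof safe
      show "x + c *\<^sub>R v \<in> F"
        using F xP v by (simp add: subspace_add subspace_scale)
      fix j assume j: "j \<in> J"
      have "\<bar>\<phi> j (x + c *\<^sub>R v)\<bar> \<le> \<bar>\<phi> j x\<bar> + \<bar>c\<bar> * \<bar>\<phi> j v\<bar>"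
        using add[OF j xP(1) subspace_scale[OF F v]] scale[OF j v, of c]
        by (simp add: abs_mult[symmetric])
      also have "\<dots> \<le> \<bar>\<phi> j x\<bar> + \<epsilon> * \<bar>\<phi> j v\<bar>"
        using that by (simp add: mult_right_mono)
      finally show "\<bar>\<phi> j (x + c *\<^sub>R v)\<bar> \<le> 1" using \<epsilon>(2)[OF j] by simp
    qed
    show "x = y"
    proof (rule ccontr)
      assume "x \<noteq> y"
      then have "v \<noteq> 0" by (simp add: v_def)
      have "x \<in> open_segment (x + (- \<epsilon>) *\<^sub>R v) (x + \<epsilon> *\<^sub>R v)"
        unfolding in_segment
      proof (intro conjI exI[of _ "1/2"])
        show "x + (- \<epsilon>) *\<^sub>R v \<noteq> x + \<epsilon> *\<^sub>R v"
        proof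
          assume "x + (- \<epsilon>) *\<^sub>R v = x + \<epsilon> *\<^sub>R v"
          then have "- \<epsilon> = \<epsilon> \<or> v = 0"
            by (simp only: add_left_cancel scaleR_cancel_right)
          with \<open>v \<noteq> 0\<close> have "- \<epsilon> = \<epsilon>" by simp
          with \<epsilon>(1) show False by simp
        qed
        show "x = (1 - 1/2) *\<^sub>R (x + (- \<epsilon>) *\<^sub>R v) + (1/2) *\<^sub>R (x + \<epsilon> *\<^sub>R v)"
        proof -
          have "(1 - 1/2) *\<^sub>R (x + (- \<epsilon>) *\<^sub>R v) + (1/2) *\<^sub>R (x + \<epsilon> *\<^sub>R v) = (1/2) *\<^sub>R (x + x)"
            by (simp add: algebra_simps)
          then show ?thesis by (simp only: scaleR_half_double)
        qed
      qed auto
      moreover have "x + (- \<epsilon>) *\<^sub>R v \<in> ?P" "x + \<epsilon> *\<^sub>R v \<in> ?P"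
        using \<epsilon>(1) by (intro in_P; simp)+
      ultimately show False
        using x unfolding extreme_point_of_def by blast
    qed
  qed
  moreover have "finite (A ` {x. x extreme_point_of ?P})"
    by (rule finite_subset[of _ "Pow J \<times> Pow J"]) (use J in \<open>auto simp: A_def\<close>)
  ultimately show ?thesis
    using finite_imageD by blast
qed

section \<open>The polyhedral renorming\<close>

text \<open>Pigeonhole on the values rounded down to multiples of \<open>e\<close>, with one
  representative per cell. This also covers the case where the discontinuous limit \<open>f\<close>
  is among the \<open>h i\<close>.\<close>

lemma finite_net_of_bounded_functions:
  fixes h :: "nat \<Rightarrow> 'a \<Rightarrow> real"
  assumes bd: "\<And>i k. \<bar>h i k\<bar> \<le> R i" and e: "0 < e"
  shows "\<exists>Q. finite Q \<and> (\<forall>k. \<exists>q\<in>Q. \<forall>i<n. \<bar>h i k - h i q\<bar> \<le> e)"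
proof -
  \<comment> \<open>Restriction to \<open>{..<n}\<close> places \<open>G k\<close> in a product of
    \<open>n\<close> finite integer intervals.\<close>
  define G where "G k = restrict (\<lambda>i. \<lfloor>h i k / e\<rfloor>) {..<n}" for k
  have floor: "\<lfloor>h i k / e\<rfloor> \<in> {\<lfloor>- R i / e\<rfloor>..\<lfloor>R i / e\<rfloor>}" for i k
  proof -
    have "- R i / e \<le> h i k / e" "h i k / e \<le> R i / e"
      using bd[of i k] e by (intro divide_right_mono; linarith)+
    then show ?thesis by (simp add: floor_mono)
  qed
  have "range G \<subseteq> PiE {..<n} (\<lambda>i. {\<lfloor>- R i / e\<rfloor>..\<lfloor>R i / e\<rfloor>})"
    unfolding G_def using floor by (intro image_subsetI restrict_PiE_iff[THEN iffD2]) blast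
  then have "finite (range G)"
    by (rule finite_subset) (auto intro: finite_PiE)
  have "\<bar>h i k - h i (inv G (G k))\<bar> \<le> e" if "i < n" for i k
  proof -
    have "G (inv G (G k)) i = G k i"
      by (simp add: f_inv_into_f)
    then have "\<lfloor>h i k / e\<rfloor> = \<lfloor>h i (inv G (G k)) / e\<rfloor>"
      using that by (simp add: G_def)
    then have "\<bar>h i k / e - h i (inv G (G k)) / e\<bar> \<le> 1"
      by linarith
    then show ?thesis
      using e by (simp add: abs_le_iff field_simps)
  qed
  with \<open>finite (range G)\<close> show ?thesis
    by (intro exI[of _ "inv G ` range G"]) blast
qed

locale absolutely_summable_basic_sequence =
  basic_sequence d C for d :: "nat \<Rightarrow> 'a::metric_space \<Rightarrow>\<^sub>C real" and C +
  assumes compact_UNIV: "compact (UNIV :: 'a set)"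
    and summ: "summable (\<lambda>i. \<bar>apply_bcontfun (d i) k\<bar>)"
begin

text \<open>The tolerance \<open>(1/4)^n\<close> is the square of the summand \<open>(1/2)^n\<close>
  in \<open>weight\<close>, so that net errors are eventually negligible against it.\<close>

definition net :: "nat \<Rightarrow> 'a set" where
  "net n = (SOME Q. finite Q \<and>
     (\<forall>k. \<exists>q\<in>Q. (\<Sum>i\<le>n. \<bar>apply_bcontfun (d i) k - apply_bcontfun (d i) q\<bar>) \<le> (1/4)^n))"

definition mass :: "nat \<Rightarrow> 'a \<Rightarrow> real" where
  "mass n k = (\<Sum>i\<le>n. \<bar>apply_bcontfun (d i) k\<bar>)"

text \<open>The weight decreases in the mass, so that mass escaping in a limit costs weight. The last
  summand breaks ties among the truncations at a point all of whose mass has been used up.\<close>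

definition weight :: "nat \<Rightarrow> 'a \<Rightarrow> real" where
  "weight n q = 1 + 1 / (1 + mass n q) + (1/2)^n"

text \<open>On \<open>W\<close> the projections are uniformly bounded, so the supremum is finite
  there; each level \<open>n\<close> contributes only finitely many functionals.\<close>

definition N :: "('a \<Rightarrow>\<^sub>C real) \<Rightarrow> real" where
  "N x = (SUP (n, q) \<in> Sigma UNIV net. weight n q * \<bar>apply_bcontfun (proj n x) q\<bar>)"

lemma net:
  shows finite_net: "finite (net n)"
    and net_approx: "\<exists>q\<in>net n. (\<Sum>i\<le>n. \<bar>apply_bcontfun (d i) k - apply_bcontfun (d i) q\<bar>) \<le> (1/4)^n"
proof -
  define e :: real where "e = (1/4)^n / real (Suc n)"
  have "0 < e" by (simp add: e_def)
  moreover have "\<bar>apply_bcontfun (d i) k\<bar> \<le> norm (d i)" for i k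
    using norm_bounded[of "d i" k] by simp
  ultimately obtain Q where Q: "finite Q"
    "\<And>k. \<exists>q\<in>Q. \<forall>i<Suc n. \<bar>apply_bcontfun (d i) k - apply_bcontfun (d i) q\<bar> \<le> e"
    using finite_net_of_bounded_functions[of "\<lambda>i. apply_bcontfun (d i)" "\<lambda>i. norm (d i)" e "Suc n"]
    by auto
  have "\<exists>q\<in>Q. (\<Sum>i\<le>n. \<bar>apply_bcontfun (d i) k - apply_bcontfun (d i) q\<bar>) \<le> (1/4)^n" for k
  proof -
    obtain q where "q \<in> Q" and q: "\<forall>i<Suc n. \<bar>apply_bcontfun (d i) k - apply_bcontfun (d i) q\<bar> \<le> e"
      using Q(2) by blast
    have "(\<Sum>i\<le>n. \<bar>apply_bcontfun (d i) k - apply_bcontfun (d i) q\<bar>) \<le> (\<Sum>i\<le>n. e)"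
      using q by (intro sum_mono) auto
    also have "\<dots> = (1/4)^n"
      by (simp add: e_def)
    finally show ?thesis using \<open>q \<in> Q\<close> by blast
  qed
  with Q(1) have "\<exists>Q. finite Q \<and>
     (\<forall>k. \<exists>q\<in>Q. (\<Sum>i\<le>n. \<bar>apply_bcontfun (d i) k - apply_bcontfun (d i) q\<bar>) \<le> (1/4)^n)"
    by blast
  from someI_ex[OF this] show "finite (net n)"
    and "\<exists>q\<in>net n. (\<Sum>i\<le>n. \<bar>apply_bcontfun (d i) k - apply_bcontfun (d i) q\<bar>) \<le> (1/4)^n"
    unfolding net_def[symmetric] by blast+
qed

lemma net_nonempty: "net n \<noteq> {}"
  using net_approx[of n] by blast

lemma mass_nonneg: "0 \<le> mass n k"
  by (simp add: mass_def sum_nonneg)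

lemma mass_mono: "m \<le> n \<Longrightarrow> mass m k \<le> mass n k"
  unfolding mass_def by (intro sum_mono2) auto

lemma mass_tendsto: "(\<lambda>n. mass n k) \<longlonglongrightarrow> (\<Sum>i. \<bar>apply_bcontfun (d i) k\<bar>)"
  unfolding mass_def using summable_LIMSEQ'[OF summ] .

lemma weight_ge_1: "1 \<le> weight n q"
  using mass_nonneg by (simp add: weight_def)

lemma weight_le_3: "weight n q \<le> 3"
proof -
  have "1 / (1 + mass n q) \<le> 1" "(1/2::real)^n \<le> 1"
    using mass_nonneg[of n q] by (auto simp: power_le_one)
  then show ?thesis by (simp add: weight_def)
qed

lemma abs_apply_proj_le: "x \<in> W \<Longrightarrow> \<bar>apply_bcontfun (proj n x) q\<bar> \<le> C * norm x"
  using norm_bounded[of "proj n x" q] norm_proj_le[of x n] by simp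

lemma weighted_le: "x \<in> W \<Longrightarrow> weight n q * \<bar>apply_bcontfun (proj n x) q\<bar> \<le> 3 * (C * norm x)"
  using weight_ge_1[of n q] by (intro mult_mono weight_le_3 abs_apply_proj_le) auto

section \<open>\<open>N\<close> as an equivalent norm on \<open>W\<close>\<close>

lemma N_upper:
  assumes "x \<in> W" "q \<in> net n"
  shows "weight n q * \<bar>apply_bcontfun (proj n x) q\<bar> \<le> N x"
proof -
  have "bdd_above ((\<lambda>(n, q). weight n q * \<bar>apply_bcontfun (proj n x) q\<bar>) ` Sigma UNIV net)"
    using weighted_le[OF assms(1)] by (intro bdd_aboveI2[of _ _ "3 * (C * norm x)"]) auto
  from cSUP_upper[OF _ this, of "(n, q)"] assms(2) show ?thesis
    by (simp add: N_def)
qed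

lemma N_least:
  assumes "\<And>n q. q \<in> net n \<Longrightarrow> weight n q * \<bar>apply_bcontfun (proj n x) q\<bar> \<le> c"
  shows "N x \<le> c"
proof -
  have "Sigma UNIV net \<noteq> {}"
    using net_nonempty by blast
  then show ?thesis
    unfolding N_def using assms by (intro cSUP_least) auto
qed

lemma N_le: "x \<in> W \<Longrightarrow> N x \<le> 3 * C * norm x"
  using weighted_le by (intro N_least) (simp add: mult.assoc)

text \<open>Since all coefficients are at most \<open>C * norm x\<close>, a bound on the summed
  differences of the \<open>d i\<close> controls the projections; this is why the nets are measured
  in that distance.\<close>

lemma abs_proj_diff_le:
  assumes "x \<in> W" "(\<Sum>i\<le>n. \<bar>apply_bcontfun (d i) k - apply_bcontfun (d i) q\<bar>) \<le> \<eta>"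
  shows "\<bar>apply_bcontfun (proj n x) k - apply_bcontfun (proj n x) q\<bar> \<le> C * norm x * \<eta>"
proof -
  have "apply_bcontfun (proj n x) k - apply_bcontfun (proj n x) q
      = (\<Sum>i\<le>n. coeff x i * (apply_bcontfun (d i) k - apply_bcontfun (d i) q))"
    by (simp add: proj_def apply_bcontfun_sum right_diff_distrib sum_subtractf)
  also have "\<bar>\<dots>\<bar> \<le> (\<Sum>i\<le>n. \<bar>coeff x i * (apply_bcontfun (d i) k - apply_bcontfun (d i) q)\<bar>)"
    by (rule sum_abs)
  also have "\<dots> \<le> (\<Sum>i\<le>n. C * norm x * \<bar>apply_bcontfun (d i) k - apply_bcontfun (d i) q\<bar>)"
    using abs_coeff_le[OF assms(1)] by (intro sum_mono) (auto simp: abs_mult intro: mult_right_mono)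
  also have "\<dots> = C * norm x * (\<Sum>i\<le>n. \<bar>apply_bcontfun (d i) k - apply_bcontfun (d i) q\<bar>)"
    by (simp add: sum_distrib_left)
  also have "\<dots> \<le> C * norm x * \<eta>"
    using assms(2) C_pos by (intro mult_left_mono) auto
  finally show ?thesis .
qed

text \<open>Weights are at least \<open>1\<close>, every point has a net point nearby at each level,
  and both the net error and the projection error vanish as \<open>n\<close> grows.\<close>

lemma norm_le_N:
  assumes "x \<in> W"
  shows "norm x \<le> N x"
proof (rule norm_bound)
  fix k
  have le: "\<bar>apply_bcontfun (proj n x) k\<bar> - C * norm x * (1/4)^n \<le> N x" for n
  proof -
    obtain q where q: "q \<in> net n"
      "(\<Sum>i\<le>n. \<bar>apply_bcontfun (d i) k - apply_bcontfun (d i) q\<bar>) \<le> (1/4)^n"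
      using net_approx by blast
    have "\<bar>apply_bcontfun (proj n x) q\<bar> \<le> weight n q * \<bar>apply_bcontfun (proj n x) q\<bar>"
      using weight_ge_1[of n q] by (simp add: mult_le_cancel_right1)
    with abs_proj_diff_le[OF assms q(2)] N_upper[OF assms q(1)] show ?thesis by linarith
  qed
  have "(\<lambda>n. \<bar>apply_bcontfun (proj n x) k\<bar> - C * norm x * (1/4)^n)
      \<longlonglongrightarrow> \<bar>apply_bcontfun x k\<bar> - C * norm x * 0"
    by (intro tendsto_intros tendsto_apply_bcontfun proj_tendsto assms LIMSEQ_power_zero) simp
  from LIMSEQ_le_const2[OF this] le show "norm (apply_bcontfun x k) \<le> N x" by auto
qed

lemma N_add:
  assumes "x \<in> W" "y \<in> W"
  shows "N (x + y) \<le> N x + N y"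
proof (rule N_least)
  fix n q assume q: "q \<in> net n"
  have "weight n q * \<bar>apply_bcontfun (proj n (x + y)) q\<bar>
      \<le> weight n q * (\<bar>apply_bcontfun (proj n x) q\<bar> + \<bar>apply_bcontfun (proj n y) q\<bar>)"
    using weight_ge_1[of n q] assms by (intro mult_left_mono) (auto simp: proj_add)
  with N_upper[OF assms(1) q] N_upper[OF assms(2) q]
  show "weight n q * \<bar>apply_bcontfun (proj n (x + y)) q\<bar> \<le> N x + N y"
    by (simp add: distrib_left)
qed

lemma N_scaleR:
  assumes "x \<in> W"
  shows "N (c *\<^sub>R x) = \<bar>c\<bar> * N x"
proof -
  have le: "N (c *\<^sub>R y) \<le> \<bar>c\<bar> * N y" if "y \<in> W" for c y
  proof (rule N_least)
    fix n q assume q: "q \<in> net n"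
    show "weight n q * \<bar>apply_bcontfun (proj n (c *\<^sub>R y)) q\<bar> \<le> \<bar>c\<bar> * N y"
      using mult_left_mono[OF N_upper[OF that q], of "\<bar>c\<bar>"] that
      by (simp add: proj_scaleR abs_mult mult_ac)
  qed
  show ?thesis
  proof (cases "c = 0")
    case True
    have "N (0 *\<^sub>R x) = 0"
      using le[OF assms, of 0] norm_le_N[OF subspace_0[OF subspace_W]] by simp
    with True show ?thesis by simp
  next
    case False
    have cx: "c *\<^sub>R x \<in> W"
      using assms subspace_W by (rule subspace_scale[rotated])
    \<comment> \<open>The reverse inequality is \<open>le\<close> for the factor
      \<open>1 / c\<close> at the vector \<open>c *\<^sub>R x\<close>.\<close>
    have "\<bar>c\<bar> * N ((1 / c) *\<^sub>R (c *\<^sub>R x)) \<le> \<bar>c\<bar> * (\<bar>1 / c\<bar> * N (c *\<^sub>R x))"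
      by (intro mult_left_mono le cx) simp
    with False le[OF assms, of c] show ?thesis
      by (simp add: abs_divide)
  qed
qed

lemma norm_on_N: "norm_on W N"
  unfolding norm_on_def
proof (intro conjI ballI allI)
  fix x assume x: "x \<in> W"
  show "0 \<le> N x"
    using norm_le_N[OF x] norm_ge_zero order_trans by blast
  show "N x = 0 \<longleftrightarrow> x = 0"
    using norm_le_N[OF x] N_le[OF x] by auto
qed (auto simp: subspace_W N_add N_scaleR)

lemma banach_on_N: "banach_on W N"
  unfolding banach_on_def
proof (intro conjI norm_on_N allI impI)
  fix s :: "nat \<Rightarrow> 'a \<Rightarrow>\<^sub>C real"
  assume s: "(\<forall>n. s n \<in> W) \<and> (\<forall>e>0. \<exists>M. \<forall>m\<ge>M. \<forall>n\<ge>M. N (s m - s n) < e)"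
  then have diff: "s m - s n \<in> W" for m n
    by (simp add: subspace_diff subspace_W)
  have "Cauchy s"
    unfolding Cauchy_def dist_norm using s norm_le_N[OF diff] by (meson le_less_trans)
  then obtain l where l: "s \<longlonglongrightarrow> l"
    using convergent_eq_Cauchy by blast
  then have lW: "l \<in> W"
    using s closed_W closed_sequentially by blast
  have "(\<lambda>n. 3 * C * norm (s n - l)) \<longlonglongrightarrow> 3 * C * norm (l - l)"
    by (intro tendsto_intros l)
  moreover have "norm (N (s n - l)) \<le> 3 * C * norm (s n - l)" for n
  proof -
    have "s n - l \<in> W"
      using s lW by (simp add: subspace_diff subspace_W)
    note N_le[OF this] order_trans[OF norm_ge_zero norm_le_N[OF this]]
    then show ?thesis by simp
  qed
  ultimately have "(\<lambda>n. N (s n - l)) \<longlonglongrightarrow> 0"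
    by (intro Lim_null_comparison[where f = "\<lambda>n. N (s n - l)"]) auto
  with lW show "\<exists>l\<in>W. (\<lambda>n. N (s n - l)) \<longlonglongrightarrow> 0" by blast
qed

lemma separable_on_N: "separable_on W N"
proof -
  obtain D where D: "D \<subseteq> W" "countable D" "\<And>x e. x \<in> W \<Longrightarrow> 0 < e \<Longrightarrow> \<exists>y\<in>D. norm (x - y) < e"
    using separable_W by metis
  have "\<exists>y\<in>D. N (x - y) < e" if x: "x \<in> W" and e: "0 < e" for x e
  proof -
    obtain y where y: "y \<in> D" "norm (x - y) < e / (3 * C)"
      using D(3)[OF x, of "e / (3 * C)"] e C_pos by auto
    have "x - y \<in> W"
      using x y(1) D(1) by (auto intro: subspace_diff subspace_W)
    from N_le[OF this] y C_pos show ?thesis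
      by (intro bexI[of _ y]) (auto simp: field_simps)
  qed
  with D show ?thesis
    unfolding separable_on_def by blast
qed

lemma isomorphic_on_N: "isomorphic_on W W N"
  unfolding isomorphic_on_def
proof (intro exI[of _ id] conjI)
  show "\<exists>a>0. \<exists>b>0. \<forall>x\<in>W. a * norm x \<le> N (id x) \<and> N (id x) \<le> b * norm x"
    using norm_le_N N_le C_pos by (intro exI[of _ 1] conjI exI[of _ "3 * C"]) auto
qed auto

text \<open>Passing from a point to a truncation of it gains weight in proportion to the discarded mass,
  whereas the value lost is that mass times coefficients which tend to \<open>0\<close>.\<close>

lemma weighted_truncation_exceeds:
  assumes x: "x \<in> W" and k: "apply_bcontfun x k \<noteq> 0"
  shows "\<exists>n. \<exists>q\<in>net n. (1 + 1 / (1 + (\<Sum>i. \<bar>apply_bcontfun (d i) k\<bar>))) * \<bar>apply_bcontfun x k\<bar>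
    < weight n q * \<bar>apply_bcontfun (proj n x) q\<bar>"
proof -
  define s where "s = (\<Sum>i. \<bar>apply_bcontfun (d i) k\<bar>)"
  define X where "X = \<bar>apply_bcontfun x k\<bar>"
  define C' where "C' = C * norm x"
  \<comment> \<open>With this \<open>\<kappa>\<close> the gain in weight,
    \<open>\<tau> / (1 + s)^2\<close> times \<open>X\<close>, equals
    \<open>3 * (\<kappa> * \<tau>)\<close> and pays for the truncation error
    \<open>\<kappa> * \<tau>\<close> taken with weight at most \<open>3\<close>.\<close>
  define \<kappa> where "\<kappa> = X / (1 + s)^2 / 3"
  have s: "0 \<le> s"
    unfolding s_def by (intro suminf_nonneg summ) simp
  have X: "0 < X" using k by (simp add: X_def)
  have C': "0 \<le> C'" using C_pos by (simp add: C'_def)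
  have \<kappa>: "0 < \<kappa>" using X s by (simp add: \<kappa>_def)
  have "\<forall>\<^sub>F i in sequentially. \<bar>coeff x i\<bar> < \<kappa>"
    using tendsto_rabs_zero[OF coeff_tendsto_0[OF x]] \<kappa> by (rule order_tendstoD)
  then obtain n0 where n0: "\<And>i. i \<ge> n0 \<Longrightarrow> \<bar>coeff x i\<bar> < \<kappa>"
    by (auto simp: eventually_sequentially)
  \<comment> \<open>The strict excess has to come from the summand \<open>(1/2)^n\<close> of the
    weight. The net errors are multiples of its square \<open>(1/4)^n\<close>, so it wins for large
    \<open>n\<close>.\<close>
  have "(\<lambda>n. (X + 3 * C') * (1/2)^n) \<longlonglongrightarrow> (X + 3 * C') * 0"
    by (intro tendsto_intros LIMSEQ_power_zero) simp
  then have "\<forall>\<^sub>F n in sequentially. (X + 3 * C') * (1/2)^n < X"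
    by (rule order_tendstoD) (use X in simp)
  then obtain n1 where n1: "\<And>n. n \<ge> n1 \<Longrightarrow> (X + 3 * C') * (1/2)^n < X"
    by (auto simp: eventually_sequentially)
  define n where "n = max n0 n1"
  define \<tau> where "\<tau> = s - mass n k"
  define \<delta> :: real where "\<delta> = (1/4)^n"
  define e :: real where "e = (1/2)^n"
  have pos: "0 < \<delta>" "0 < e" by (simp_all add: \<delta>_def e_def)
  have \<delta>: "\<delta> = e * e"
    by (simp add: \<delta>_def e_def flip: power_mult_distrib)
  have tail: "summable (\<lambda>i. \<bar>apply_bcontfun (d (i + Suc n)) k\<bar>)"
    "(\<Sum>i. \<bar>apply_bcontfun (d (i + Suc n)) k\<bar>) = \<tau>"
    using summable_ignore_initial_segment[OF summ[of k], of "Suc n"]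
      suminf_minus_initial_segment[OF summ[of k], of "Suc n"]
    by (auto simp: \<tau>_def s_def mass_def lessThan_Suc_atMost)
  have \<tau>: "0 \<le> \<tau>"
    unfolding tail(2)[symmetric] by (intro suminf_nonneg tail) simp
  have "(\<lambda>i. coeff x i * apply_bcontfun (d i) k) sums apply_bcontfun x k"
    using sums_apply_bcontfun[OF coeff_sums[OF x], of k] by simp
  then have "(\<lambda>i. coeff x (i + Suc n) * apply_bcontfun (d (i + Suc n)) k)
      sums (apply_bcontfun x k - apply_bcontfun (proj n x) k)"
    using sums_iff_shift[of "\<lambda>i. coeff x i * apply_bcontfun (d i) k" "Suc n"]
    by (simp add: proj_def apply_bcontfun_sum lessThan_Suc_atMost)
  then have tail_eq: "apply_bcontfun x k - apply_bcontfun (proj n x) k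
      = (\<Sum>i. coeff x (i + Suc n) * apply_bcontfun (d (i + Suc n)) k)"
    by (simp add: sums_iff)
  have "\<bar>apply_bcontfun x k - apply_bcontfun (proj n x) k\<bar> \<le> (\<Sum>i. \<kappa> * \<bar>apply_bcontfun (d (i + Suc n)) k\<bar>)"
    unfolding tail_eq real_norm_def[symmetric]
  proof (rule norm_suminf_le)
    show "summable (\<lambda>i. \<kappa> * norm (apply_bcontfun (d (i + Suc n)) k))"
      using tail(1) by (simp add: summable_mult)
    show "norm (coeff x (i + Suc n) * apply_bcontfun (d (i + Suc n)) k)
        \<le> \<kappa> * norm (apply_bcontfun (d (i + Suc n)) k)" for i
    proof -
      have "\<bar>coeff x (i + Suc n)\<bar> \<le> \<kappa>"
        by (intro less_imp_le n0) (simp add: n_def)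
      then show ?thesis
        unfolding real_norm_def abs_mult by (intro mult_right_mono) auto
    qed
  qed
  also have "\<dots> = \<kappa> * \<tau>"
    using tail by (simp add: suminf_mult)
  finally have trunc: "\<bar>apply_bcontfun x k - apply_bcontfun (proj n x) k\<bar> \<le> \<kappa> * \<tau>" .
  obtain q where "q \<in> net n"
    and q: "(\<Sum>i\<le>n. \<bar>apply_bcontfun (d i) k - apply_bcontfun (d i) q\<bar>) \<le> \<delta>"
    using net_approx unfolding \<delta>_def by blast
  have lower: "X - \<kappa> * \<tau> - C' * \<delta> \<le> \<bar>apply_bcontfun (proj n x) q\<bar>"
    using trunc abs_proj_diff_le[OF x q] unfolding X_def C'_def by linarith
  have "mass n q - mass n k \<le> (\<Sum>i\<le>n. \<bar>apply_bcontfun (d i) k - apply_bcontfun (d i) q\<bar>)"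
    unfolding mass_def sum_subtractf[symmetric] by (intro sum_mono) linarith
  with q have mass: "mass n q \<le> s - \<tau> + \<delta>"
    by (simp add: \<tau>_def)
  have mass': "0 \<le> s - \<tau>"
    using mass_nonneg[of n k] by (simp add: \<tau>_def)
  \<comment> \<open>The mass at \<open>q\<close> is at most \<open>s - \<tau> + \<delta>\<close>:
    lowering \<open>s\<close> by \<open>\<tau>\<close> gains at least
    \<open>\<tau> / (1 + s)^2\<close> in the reciprocal, and adding \<open>\<delta>\<close> costs at
    most \<open>\<delta>\<close>.\<close>
  have "1 / (1 + s) + \<tau> / (1 + s)^2 - \<delta> \<le> 1 / (1 + mass n q)"
  proof -
    have "\<tau> / (1 + s)^2 \<le> \<tau> / ((1 + (s - \<tau>)) * (1 + s))"
      using \<tau> mass' s unfolding power2_eq_square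
      by (intro divide_left_mono mult_right_mono mult_pos_pos) auto
    also have "\<dots> = 1 / (1 + (s - \<tau>)) - 1 / (1 + s)"
      using mass' s by (simp add: field_simps add_nonneg_eq_0_iff)
    finally have 1: "1 / (1 + s) + \<tau> / (1 + s)^2 \<le> 1 / (1 + (s - \<tau>))" by simp
    have "1 / (1 + (s - \<tau>)) - 1 / (1 + (s - \<tau>) + \<delta>) = \<delta> / ((1 + (s - \<tau>)) * (1 + (s - \<tau>) + \<delta>))"
    proof -
      have "1 + (s - \<tau>) \<noteq> 0" "1 + (s - \<tau>) + \<delta> \<noteq> 0" using mass' pos by linarith+
      then show ?thesis by (simp add: divide_simps)
    qed
    also have "\<dots> \<le> \<delta> / 1"
      using mass' pos by (intro divide_left_mono mult_ge1_I) auto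
    finally have 2: "1 / (1 + (s - \<tau>)) - \<delta> \<le> 1 / (1 + (s - \<tau>) + \<delta>)" by simp
    have "1 / (1 + (s - \<tau>) + \<delta>) \<le> 1 / (1 + mass n q)"
      using mass mass_nonneg[of n q] by (intro divide_left_mono) auto
    with 1 2 show ?thesis by linarith
  qed
  then have "1 + 1 / (1 + s) + \<tau> / (1 + s)^2 - \<delta> + e \<le> weight n q"
    by (simp add: weight_def e_def)
  then have "(1 + 1 / (1 + s) + \<tau> / (1 + s)^2 - \<delta> + e) * X \<le> weight n q * X"
    using X by (intro mult_right_mono) auto
  moreover have "(1 + 1 / (1 + s) + \<tau> / (1 + s)^2 - \<delta> + e) * X
      = (1 + 1 / (1 + s)) * X + 3 * (\<kappa> * \<tau>) - \<delta> * X + e * X"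
    by (simp add: \<kappa>_def algebra_simps)
  moreover have "weight n q * (\<kappa> * \<tau> + C' * \<delta>) \<le> 3 * (\<kappa> * \<tau> + C' * \<delta>)"
    using weight_le_3 \<kappa> \<tau> C' pos by (intro mult_right_mono) auto
  moreover have "weight n q * (X - \<kappa> * \<tau> - C' * \<delta>) \<le> weight n q * \<bar>apply_bcontfun (proj n x) q\<bar>"
    using lower weight_ge_1[of n q] by (intro mult_left_mono) auto
  moreover have "(X + 3 * C') * e < X"
    using n1[of n] by (simp add: n_def e_def)
  then have "e * ((X + 3 * C') * e) < e * X"
    using pos by simp
  then have "\<delta> * X + 3 * (C' * \<delta>) < e * X"
    by (simp add: \<delta> algebra_simps)
  ultimately have "(1 + 1 / (1 + s)) * X < weight n q * \<bar>apply_bcontfun (proj n x) q\<bar>"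
    by (simp add: algebra_simps)
  with \<open>q \<in> net n\<close> show ?thesis
    unfolding s_def X_def by blast
qed

text \<open>The bound \<open>M\<close> serves a whole neighbourhood, so compactness of a sphere can
  make it global. A failure at \<open>x\<close> yields a limit point \<open>k\<close> of net points
  at which \<open>weighted_truncation_exceeds\<close> is contradicted.\<close>

lemma locally_finitely_many_levels:
  assumes x: "x \<in> W" "x \<noteq> 0"
  shows "\<exists>\<rho>>0. \<exists>M. \<forall>y\<in>W. norm (y - x) < \<rho> \<longrightarrow> (\<forall>n. \<forall>q\<in>net n. \<exists>m\<le>M. \<exists>q'\<in>net m.
    weight n q * \<bar>apply_bcontfun (proj n y) q\<bar> \<le> weight m q' * \<bar>apply_bcontfun (proj m y) q'\<bar>)"
proof (rule ccontr)
  assume neg: "\<not> ?thesis"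
  have "\<exists>y n q. y \<in> W \<and> norm (y - x) < 1 / real (Suc j) \<and> q \<in> net n \<and> (\<forall>m\<le>j. \<forall>q'\<in>net m.
    weight m q' * \<bar>apply_bcontfun (proj m y) q'\<bar> < weight n q * \<bar>apply_bcontfun (proj n y) q\<bar>)" for j
    using neg[simplified, rule_format, of "1 / real (Suc j)" j] by (force simp: not_le)
  then obtain Y l p where Y: "\<And>j. Y j \<in> W" "\<And>j. norm (Y j - x) < 1 / real (Suc j)"
    and p: "\<And>j. p j \<in> net (l j)"
    and less: "\<And>j m q'. m \<le> j \<Longrightarrow> q' \<in> net m \<Longrightarrow> weight m q' * \<bar>apply_bcontfun (proj m (Y j)) q'\<bar>
      < weight (l j) (p j) * \<bar>apply_bcontfun (proj (l j) (Y j)) (p j)\<bar>"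
    by metis
  \<comment> \<open>For \<open>l j \<le> j\<close> the strict inequality \<open>less\<close> would
    compare the term at \<open>p j\<close> with itself.\<close>
  have l: "j < l j" for j
    using less[of "l j" j "p j"] p[of j] by (meson less_irrefl not_le)
  obtain k r where r: "strict_mono (r :: nat \<Rightarrow> nat)" and k: "(p \<circ> r) \<longlonglongrightarrow> k"
    using compact_UNIV unfolding compact_def by (metis UNIV_I)
  have r_top: "filterlim r at_top sequentially"
    by (rule filterlim_subseq[OF r])
  have lr_top: "filterlim (\<lambda>j. l (r j)) at_top sequentially"
    using r_top by (rule filterlim_at_top_mono) (simp add: l less_imp_le)
  have "(\<lambda>j. norm (Y j - x)) \<longlonglongrightarrow> 0"
    by (rule tendsto_sandwich[OF _ _ tendsto_const LIMSEQ_inverse_real_of_nat])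
      (use Y(2) in \<open>auto intro!: always_eventually less_imp_le simp: inverse_eq_divide simp del: of_nat_Suc\<close>)
  then have Y_lim: "(\<lambda>j. Y (r j)) \<longlonglongrightarrow> x"
    using filterlim_compose[OF LIM_zero_cancel[OF tendsto_norm_zero_cancel] r_top, of Y x] by simp
  have proj_lim: "(\<lambda>j. proj (l (r j)) (Y (r j))) \<longlonglongrightarrow> x"
  proof -
    have "(\<lambda>j. C * norm (Y (r j) - x) + norm (proj (l (r j)) x - x)) \<longlonglongrightarrow> C * norm (x - x) + norm (x - x)"
      by (intro tendsto_intros Y_lim filterlim_compose[OF proj_tendsto[OF x(1)] lr_top])
    moreover have "norm (proj (l (r j)) (Y (r j)) - x)
        \<le> C * norm (Y (r j) - x) + norm (proj (l (r j)) x - x)" for j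
    proof -
      have "Y (r j) - x \<in> W"
        using Y(1) x(1) by (intro subspace_diff subspace_W)
      from norm_proj_le[OF this, of "l (r j)"] show ?thesis
        using norm_triangle_ineq[of "proj (l (r j)) (Y (r j)) - proj (l (r j)) x" "proj (l (r j)) x - x"]
        by (simp add: proj_diff Y x)
    qed
    ultimately have "(\<lambda>j. proj (l (r j)) (Y (r j)) - x) \<longlonglongrightarrow> 0"
      by (intro Lim_null_comparison[where f = "\<lambda>j. proj (l (r j)) (Y (r j)) - x"]) auto
    then show ?thesis by (simp add: LIM_zero_iff)
  qed
  have apply_lim: "(\<lambda>j. apply_bcontfun w (p (r j))) \<longlonglongrightarrow> apply_bcontfun w k" for w :: "'a \<Rightarrow>\<^sub>C real"
    using continuous_on_tendsto_compose[OF continuous_on_apply_bcontfun[of UNIV w] k] by (simp add: o_def)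
  have value_lim: "(\<lambda>j. apply_bcontfun (proj (l (r j)) (Y (r j))) (p (r j))) \<longlonglongrightarrow> apply_bcontfun x k"
  proof -
    have "(\<lambda>j. apply_bcontfun (proj (l (r j)) (Y (r j)) - x) (p (r j))) \<longlonglongrightarrow> 0"
    proof (rule Lim_null_comparison)
      show "(\<lambda>j. norm (proj (l (r j)) (Y (r j)) - x)) \<longlonglongrightarrow> 0"
        using proj_lim by (simp add: LIM_zero_iff tendsto_norm_zero_iff)
    qed (use norm_bounded in \<open>blast intro: always_eventually\<close>)
    from tendsto_add[OF this apply_lim[of x]] show ?thesis by simp
  qed
  \<comment> \<open>The masses up to the varying level \<open>l (r j)\<close> need not converge to
    the total mass at \<open>k\<close>. They are therefore bounded below by the continuous function
    \<open>mass L\<close> with \<open>L\<close> fixed; \<open>L\<close> tends to infinity only after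
    \<open>j\<close>.\<close>
  have le_mass: "weight m q' * \<bar>apply_bcontfun (proj m x) q'\<bar> \<le> (1 + 1 / (1 + mass L k)) * \<bar>apply_bcontfun x k\<bar>"
    if q': "q' \<in> net m" for m q' L
  proof (rule tendsto_le[OF trivial_limit_sequentially])
    have "(\<lambda>j. proj m (Y (r j))) \<longlonglongrightarrow> proj m x"
    proof -
      have "(\<lambda>j. C * norm (Y (r j) - x)) \<longlonglongrightarrow> C * norm (x - x)"
        by (intro tendsto_intros Y_lim)
      moreover have "norm (proj m (Y (r j)) - proj m x) \<le> C * norm (Y (r j) - x)" for j
        using norm_proj_le[of "Y (r j) - x" m] Y(1) x(1)
        by (simp add: proj_diff subspace_diff subspace_W)
      ultimately have "(\<lambda>j. proj m (Y (r j)) - proj m x) \<longlonglongrightarrow> 0"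
        by (intro Lim_null_comparison[where f = "\<lambda>j. proj m (Y (r j)) - proj m x"]) auto
      then show ?thesis by (simp add: LIM_zero_iff)
    qed
    then show "(\<lambda>j. weight m q' * \<bar>apply_bcontfun (proj m (Y (r j))) q'\<bar>)
        \<longlonglongrightarrow> weight m q' * \<bar>apply_bcontfun (proj m x) q'\<bar>"
      by (intro tendsto_intros tendsto_apply_bcontfun)
    have "(\<lambda>j. mass L (p (r j))) \<longlonglongrightarrow> mass L k"
      unfolding mass_def by (intro tendsto_intros apply_lim)
    moreover have "(\<lambda>j. (1/2::real)^l (r j)) \<longlonglongrightarrow> 0"
      by (rule filterlim_compose[OF _ lr_top]) (simp add: LIMSEQ_power_zero)
    ultimately show "(\<lambda>j. (1 + 1 / (1 + mass L (p (r j))) + (1/2)^l (r j))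
          * \<bar>apply_bcontfun (proj (l (r j)) (Y (r j))) (p (r j))\<bar>)
        \<longlonglongrightarrow> (1 + 1 / (1 + mass L k)) * \<bar>apply_bcontfun x k\<bar>"
      using mass_nonneg[of L k] value_lim by (auto intro!: tendsto_eq_intros)
    have "\<forall>\<^sub>F j in sequentially. max m L \<le> r j"
      using r_top unfolding filterlim_at_top by blast
    then show "\<forall>\<^sub>F j in sequentially. weight m q' * \<bar>apply_bcontfun (proj m (Y (r j))) q'\<bar>
        \<le> (1 + 1 / (1 + mass L (p (r j))) + (1/2)^l (r j))
          * \<bar>apply_bcontfun (proj (l (r j)) (Y (r j))) (p (r j))\<bar>"
    proof eventually_elim
      case (elim j)
      have "weight m q' * \<bar>apply_bcontfun (proj m (Y (r j))) q'\<bar>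
          \<le> weight (l (r j)) (p (r j)) * \<bar>apply_bcontfun (proj (l (r j)) (Y (r j))) (p (r j))\<bar>"
        using less[of m "r j" q'] elim q' by simp
      also have "\<dots> \<le> (1 + 1 / (1 + mass L (p (r j))) + (1/2)^l (r j))
          * \<bar>apply_bcontfun (proj (l (r j)) (Y (r j))) (p (r j))\<bar>"
      proof (rule mult_right_mono)
        have "mass L (p (r j)) \<le> mass (l (r j)) (p (r j))"
          using l[of "r j"] elim by (intro mass_mono) simp
        then show "weight (l (r j)) (p (r j)) \<le> 1 + 1 / (1 + mass L (p (r j))) + (1/2)^l (r j)"
          using mass_nonneg[of L "p (r j)"] unfolding weight_def
          by (intro add_mono order_refl divide_left_mono) auto
      qed simp
      finally show ?case .
    qed
  qed
  define s where "s = (\<Sum>i. \<bar>apply_bcontfun (d i) k\<bar>)"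
  have "0 \<le> s"
    unfolding s_def by (intro suminf_nonneg summ) simp
  have le: "weight m q' * \<bar>apply_bcontfun (proj m x) q'\<bar> \<le> (1 + 1 / (1 + s)) * \<bar>apply_bcontfun x k\<bar>"
    if q': "q' \<in> net m" for m q'
  proof (rule LIMSEQ_le_const)
    show "(\<lambda>L. (1 + 1 / (1 + mass L k)) * \<bar>apply_bcontfun x k\<bar>) \<longlonglongrightarrow> (1 + 1 / (1 + s)) * \<bar>apply_bcontfun x k\<bar>"
      using mass_tendsto[of k] \<open>0 \<le> s\<close> unfolding s_def by (auto intro!: tendsto_eq_intros)
  qed (use le_mass[OF q'] in blast)
  \<comment> \<open>A zero value at \<open>k\<close> would make every weighted value of
    \<open>x\<close>, hence \<open>N x\<close>, at most \<open>0\<close>.\<close>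
  have "apply_bcontfun x k \<noteq> 0"
  proof
    assume "apply_bcontfun x k = 0"
    with le have "N x \<le> 0" by (intro N_least) simp
    with norm_le_N[OF x(1)] x(2) show False
      by (meson norm_le_zero_iff order_trans)
  qed
  from weighted_truncation_exceeds[OF x(1) this] le show False
    unfolding s_def by (meson not_le)
qed

text \<open>Finitely many neighbourhoods cover the unit sphere of \<open>F\<close>, so one level
  bound \<open>M'\<close> works on it, and by homogeneity of \<open>dom\<close> on all of
  \<open>F\<close>. The unit ball of \<open>F\<close> is then cut out by the finitely many
  functionals of level at most \<open>M'\<close>.\<close>

lemma polyhedral_on_N: "polyhedral_on W N"
  unfolding polyhedral_on_def
proof (intro conjI allI impI infinite_dimensional)
  fix F assume "subspace F \<and> F \<subseteq> W \<and> (\<exists>B. finite B \<and> F = span B)"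
  then obtain B where F: "subspace F" "F \<subseteq> W" and B: "finite B" "F = span B" by blast
  define dom where "dom M y \<longleftrightarrow> (\<forall>n. \<forall>q\<in>net n. \<exists>m\<le>M. \<exists>q'\<in>net m.
    weight n q * \<bar>apply_bcontfun (proj n y) q\<bar> \<le> weight m q' * \<bar>apply_bcontfun (proj m y) q'\<bar>)" for M y
  have dom_mono: "dom M' y" if "dom M y" "M \<le> M'" for M M' y
    using that unfolding dom_def by (meson order_trans)
  let ?S = "F \<inter> sphere 0 1"
  have "\<exists>\<rho> M. 0 < \<rho> \<and> (\<forall>y\<in>W. norm (y - x) < \<rho> \<longrightarrow> dom M y)" if "x \<in> ?S" for x
  proof -
    have "x \<in> W" "x \<noteq> 0" using that F(2) by auto
    from locally_finitely_many_levels[OF this, folded dom_def] show ?thesis by blast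
  qed
  then obtain \<rho> M where \<rho>: "\<And>x. x \<in> ?S \<Longrightarrow> 0 < \<rho> x"
    "\<And>x y. x \<in> ?S \<Longrightarrow> y \<in> W \<Longrightarrow> norm (y - x) < \<rho> x \<Longrightarrow> dom (M x) y"
    by metis
  have "compact ?S"
    using compact_finite_dim_sphere B by blast
  then obtain T where T: "T \<subseteq> ?S" "finite T" "?S \<subseteq> (\<Union>x\<in>T. ball x (\<rho> x))"
    by (rule compactE_image[of ?S ?S "\<lambda>x. ball x (\<rho> x)"]) (use \<rho>(1) in auto)
  define M' where "M' = Max (insert 0 (M ` T))"
  have dom_sphere: "dom M' y" if y: "y \<in> ?S" for y
  proof -
    obtain x where x: "x \<in> T" "y \<in> ball x (\<rho> x)" using T(3) y by blast
    moreover have "x \<in> ?S" "y \<in> W"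
      using x(1) T(1) y F(2) by blast+
    ultimately have "dom (M x) y"
      using \<rho>(2)[of x y] by (simp add: dist_norm norm_minus_commute)
    moreover have "M x \<le> M'"
      unfolding M'_def using x(1) T(2) by (intro Max_ge) auto
    ultimately show ?thesis by (rule dom_mono)
  qed
  have dom_F: "dom M' y" if "y \<in> F" for y
  proof (cases "y = 0")
    case True
    have "proj n 0 = 0" for n
      using proj_scaleR[OF subspace_0[OF subspace_W], of n 0] by simp
    moreover obtain q where "q \<in> net 0"
      using net_nonempty by blast
    ultimately show ?thesis
      using True unfolding dom_def by (auto intro!: exI[of _ "0::nat"])
  next
    case False
    define c where "c = 1 / norm y"
    have c: "0 < c" using False by (simp add: c_def)
    have yW: "y \<in> W" using that F by blast
    have "c *\<^sub>R y \<in> ?S"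
      using False subspace_scale[OF F(1) that] by (simp add: c_def)
    then have dom: "dom M' (c *\<^sub>R y)"
      by (rule dom_sphere)
    have scale: "weight n q * \<bar>apply_bcontfun (proj n (c *\<^sub>R y)) q\<bar>
        = c * (weight n q * \<bar>apply_bcontfun (proj n y) q\<bar>)" for n q
      using c by (simp add: proj_scaleR[OF yW] abs_mult)
    show ?thesis
      using dom unfolding dom_def scale mult_le_cancel_left_pos[OF c] .
  qed
  define J where "J = Sigma {..M'} net"
  define \<phi> where "\<phi> = (\<lambda>(n, q) y. weight n q * apply_bcontfun (proj n y) q)"
  have abs_\<phi>: "\<bar>\<phi> (n, q) y\<bar> = weight n q * \<bar>apply_bcontfun (proj n y) q\<bar>" for n q y
    using weight_ge_1[of n q] by (simp add: \<phi>_def abs_mult)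
  have "N y \<le> 1 \<longleftrightarrow> (\<forall>j\<in>J. \<bar>\<phi> j y\<bar> \<le> 1)" if "y \<in> F" for y
  proof
    assume "N y \<le> 1"
    then show "\<forall>j\<in>J. \<bar>\<phi> j y\<bar> \<le> 1"
      using N_upper[of y] that F(2) by (force simp: J_def abs_\<phi>)
  next
    assume le: "\<forall>j\<in>J. \<bar>\<phi> j y\<bar> \<le> 1"
    show "N y \<le> 1"
    proof (rule N_least)
      fix n q assume "q \<in> net n"
      with dom_F[OF that] obtain m q' where mq: "m \<le> M'" "q' \<in> net m"
        "weight n q * \<bar>apply_bcontfun (proj n y) q\<bar> \<le> weight m q' * \<bar>apply_bcontfun (proj m y) q'\<bar>"
        unfolding dom_def by blast
      have "\<bar>\<phi> (m, q') y\<bar> \<le> 1" using le mq by (simp add: J_def)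
      with mq(3) show "weight n q * \<bar>apply_bcontfun (proj n y) q\<bar> \<le> 1" by (simp add: abs_\<phi>)
    qed
  qed
  then have "{y\<in>F. N y \<le> 1} = {y\<in>F. \<forall>j\<in>J. \<bar>\<phi> j y\<bar> \<le> 1}" by auto
  moreover have "finite {x. x extreme_point_of {y\<in>F. \<forall>j\<in>J. \<bar>\<phi> j y\<bar> \<le> 1}}"
  proof (rule finite_extreme_points_of_polytope[OF F(1)])
    show "finite J"
      by (simp add: J_def finite_net)
  qed (use F(2) in \<open>auto simp: \<phi>_def proj_add proj_scaleR distrib_left subset_iff\<close>)
  ultimately show "finite {x. x extreme_point_of {y\<in>F. N y \<le> 1}}" by simp
qed

end

section \<open>Choice of the convex blocks\<close>

lemma convex_combination_abs_le:
  fixes c x :: "'i \<Rightarrow> real"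
  assumes "\<And>i. i \<in> F \<Longrightarrow> 0 \<le> c i" "sum c F = 1" "\<And>i. i \<in> F \<Longrightarrow> \<bar>x i\<bar> \<le> \<eta>"
  shows "\<bar>\<Sum>i\<in>F. c i * x i\<bar> \<le> \<eta>"
proof -
  have "\<bar>\<Sum>i\<in>F. c i * x i\<bar> \<le> (\<Sum>i\<in>F. c i * \<bar>x i\<bar>)"
    using assms(1) by (intro order_trans[OF sum_abs] sum_mono) (simp add: abs_mult)
  also have "\<dots> \<le> (\<Sum>i\<in>F. c i * \<eta>)"
    using assms by (intro sum_mono mult_left_mono) auto
  also have "\<dots> = \<eta>"
    using assms(2) by (simp flip: sum_distrib_right)
  finally show ?thesis .
qed

lemma convex_combination_diff:
  fixes c x :: "'i \<Rightarrow> real"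
  assumes "sum c F = 1"
  shows "(\<Sum>i\<in>F. c i * x i) - y = (\<Sum>i\<in>F. c i * (x i - y))"
  using assms by (simp add: right_diff_distrib sum_subtractf flip: sum_distrib_right)

lemma convex_block_small_norm:
  fixes u :: "nat \<Rightarrow> 'a::metric_space \<Rightarrow>\<^sub>C real"
  assumes "compact (UNIV :: 'a set)" "\<And>n. norm (u n) \<le> B"
    and "\<And>k. (\<lambda>n. apply_bcontfun (u n) k) \<longlonglongrightarrow> 0" "0 < \<epsilon>"
  shows "\<exists>F c. finite F \<and> F \<noteq> {} \<and> F \<subseteq> {I..} \<and> (\<forall>i. 0 \<le> c i) \<and> sum c F = 1 \<and>
    norm (\<Sum>i\<in>F. c i *\<^sub>R u i) < \<epsilon>"
proof -
  obtain v where v: "v \<in> convex hull (u ` {I..})" "norm v < \<epsilon>"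
    using convex_hull_tail_small_norm[OF assms] by blast
  then obtain S U where S: "finite S" "S \<subseteq> u ` {I..}" and U: "\<And>x. x \<in> S \<Longrightarrow> 0 \<le> U x" "sum U S = 1"
    and v_eq: "(\<Sum>x\<in>S. U x *\<^sub>R x) = v"
    unfolding convex_hull_explicit by blast
  \<comment> \<open>Since \<open>u\<close> may repeat values, one index is selected for each point
    of \<open>S\<close>, so that the weights can be transferred to indices.\<close>
  obtain F where F: "F \<subseteq> {I..}" "inj_on u F" "S = u ` F"
    using S(2) by (auto simp: subset_image_inj)
  define c where "c i = (if i \<in> F then U (u i) else 0)" for i
  have "finite F"
    using S(1) F finite_imageD by blast
  moreover have "sum c F = 1"
    using U(2) F by (simp add: c_def sum.reindex)
  moreover have "F \<noteq> {}"
    using \<open>sum c F = 1\<close> by auto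
  moreover have "(\<Sum>i\<in>F. c i *\<^sub>R u i) = v"
    using v_eq F by (simp add: c_def sum.reindex)
  moreover have "\<forall>i. 0 \<le> c i"
    using U(1) F(3) by (simp add: c_def)
  ultimately show ?thesis
    using F(1) v(2) by (intro exI[of _ F] exI[of _ c]) simp
qed

text \<open>Each block has two duties: its average of \<open>fs - hs\<close> is small in norm, and
  its functions are close to \<open>f\<close> on the finite nets fixed so far. The second holds for
  all far out indices and the first can be met among them.\<close>

lemma convex_block_selection:
  fixes fs hs :: "nat \<Rightarrow> 'a::metric_space \<Rightarrow>\<^sub>C real" and f :: "'a \<Rightarrow> real" and \<eta> :: "nat \<Rightarrow> real"
  assumes K: "compact (UNIV :: 'a set)"
    and fs_bd: "\<And>n. norm (fs n) \<le> B" and hs_bd: "\<And>n. norm (hs n) \<le> B'"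
    and fs_lim: "\<And>k. (\<lambda>n. apply_bcontfun (fs n) k) \<longlonglongrightarrow> f k"
    and hs_lim: "\<And>k. (\<lambda>n. apply_bcontfun (hs n) k) \<longlonglongrightarrow> f k"
    and \<eta>_pos: "\<And>n. 0 < \<eta> n" and \<eta>_dec: "decseq \<eta>"
  obtains F :: "nat \<Rightarrow> nat set" and c :: "nat \<Rightarrow> real" and p :: "nat \<Rightarrow> nat"
  where "strict_mono p" "\<And>n. finite (F n)" "\<And>n. F n \<noteq> {}" "\<And>n. F n \<subseteq> {p n..<p (Suc n)}"
    "\<And>i. 0 \<le> c i" "\<And>n. sum c (F n) = 1"
    "\<And>n. norm (\<Sum>i\<in>F n. c i *\<^sub>R (fs i - hs i)) \<le> (1/2)^n"
    "\<And>n. \<exists>Q. (\<forall>k. \<exists>q\<in>Q. \<bar>f k - f q\<bar> \<le> \<eta> n \<and> (\<forall>i<p n. \<bar>apply_bcontfun (fs i) k - apply_bcontfun (fs i) q\<bar> \<le> \<eta> n)) \<and>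
      (\<forall>j\<ge>n. \<forall>i\<in>F j. \<forall>q\<in>Q. \<bar>apply_bcontfun (fs i) q - f q\<bar> \<le> \<eta> j)"
proof -
  have fs_le: "\<bar>apply_bcontfun (fs i) k\<bar> \<le> B" for i k
    using norm_bounded[of "fs i" k] fs_bd[of i] by simp
  have f_le: "\<bar>f k\<bar> \<le> B" for k
    by (rule LIMSEQ_le_const2[OF tendsto_rabs[OF fs_lim]]) (use fs_le in blast)
  have "\<exists>Q. finite Q \<and> (\<forall>k. \<exists>q\<in>Q. \<bar>f k - f q\<bar> \<le> \<eta> m \<and>
      (\<forall>i<m. \<bar>apply_bcontfun (fs i) k - apply_bcontfun (fs i) q\<bar> \<le> \<eta> m))" for m
  proof -
    \<comment> \<open>Index \<open>0\<close> carries the limit \<open>f\<close>, so one net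
      approximates \<open>f\<close> together with the first \<open>m\<close> functions.\<close>
    let ?h = "\<lambda>i. case i of 0 \<Rightarrow> f | Suc i \<Rightarrow> apply_bcontfun (fs i)"
    have "\<bar>?h i k\<bar> \<le> B" for i k
      using fs_le f_le by (cases i) auto
    from finite_net_of_bounded_functions[of ?h "\<lambda>_. B", OF this \<eta>_pos, where n = "Suc m"]
    obtain Q where "finite Q" and Q: "\<forall>k. \<exists>q\<in>Q. \<forall>i<Suc m. \<bar>?h i k - ?h i q\<bar> \<le> \<eta> m"
      by blast
    have "\<exists>q\<in>Q. \<bar>f k - f q\<bar> \<le> \<eta> m \<and>
      (\<forall>i<m. \<bar>apply_bcontfun (fs i) k - apply_bcontfun (fs i) q\<bar> \<le> \<eta> m)" for k
    proof -
      obtain q where "q \<in> Q" and q: "\<And>i. i < Suc m \<Longrightarrow> \<bar>?h i k - ?h i q\<bar> \<le> \<eta> m"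
        using Q by blast
      from \<open>q \<in> Q\<close> q[of 0] q[of "Suc i" for i] show ?thesis by auto
    qed
    with \<open>finite Q\<close> show ?thesis by blast
  qed
  then obtain Q where finite_Q: "\<And>m. finite (Q m)"
    and Q: "\<And>m k. \<exists>q\<in>Q m. \<bar>f k - f q\<bar> \<le> \<eta> m \<and>
      (\<forall>i<m. \<bar>apply_bcontfun (fs i) k - apply_bcontfun (fs i) q\<bar> \<le> \<eta> m)"
    by metis
  \<comment> \<open>The demands on a block starting at or after \<open>m\<close> do not refer to the
    other blocks; the recursion for \<open>p\<close> only decides where the next one starts.\<close>
  define step where "step m G a \<longleftrightarrow> finite G \<and> G \<noteq> {} \<and> G \<subseteq> {m..} \<and> (\<forall>i. 0 \<le> a i) \<and> sum a G = 1 \<and>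
      norm (\<Sum>i\<in>G. a i *\<^sub>R (fs i - hs i)) \<le> (1/2)^m \<and>
      (\<forall>i\<in>G. \<forall>q\<in>\<Union>(Q ` {..m}). \<bar>apply_bcontfun (fs i) q - f q\<bar> \<le> \<eta> m)" for m G a
  have "\<exists>G a. step m G a" for m
  proof -
    have "\<forall>\<^sub>F i in sequentially. \<forall>q\<in>\<Union>(Q ` {..m}). \<bar>apply_bcontfun (fs i) q - f q\<bar> < \<eta> m"
    proof (rule eventually_ball_finite)
      show "finite (\<Union>(Q ` {..m}))"
        using finite_Q by auto
      have "\<forall>\<^sub>F i in sequentially. \<bar>apply_bcontfun (fs i) q - f q\<bar> < \<eta> m" for q
        using tendstoD[OF fs_lim[of q] \<eta>_pos[of m]] by (simp add: dist_real_def)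
      then show "\<forall>q\<in>\<Union>(Q ` {..m}). \<forall>\<^sub>F i in sequentially. \<bar>apply_bcontfun (fs i) q - f q\<bar> < \<eta> m"
        by blast
    qed
    then obtain I where I: "\<And>i q. i \<ge> I \<Longrightarrow> q \<in> \<Union>(Q ` {..m}) \<Longrightarrow> \<bar>apply_bcontfun (fs i) q - f q\<bar> < \<eta> m"
      unfolding eventually_sequentially by blast
    have bd: "norm (fs n - hs n) \<le> B + B'" for n
      using norm_triangle_ineq4[of "fs n" "hs n"] fs_bd[of n] hs_bd[of n] by linarith
    have lim: "(\<lambda>n. apply_bcontfun (fs n - hs n) k) \<longlonglongrightarrow> 0" for k
      using tendsto_diff[OF fs_lim hs_lim, of k k] by simp
    obtain G a where G: "finite G" "G \<noteq> {}" "G \<subseteq> {max I m..}" "\<forall>i. 0 \<le> a i" "sum a G = 1"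
      "norm (\<Sum>i\<in>G. a i *\<^sub>R (fs i - hs i)) < (1/2)^m"
      using convex_block_small_norm[OF K bd lim, of "(1/2)^m" "max I m"] by auto
    moreover have "\<forall>i\<in>G. \<forall>q\<in>\<Union>(Q ` {..m}). \<bar>apply_bcontfun (fs i) q - f q\<bar> \<le> \<eta> m"
      using G(3) by (intro ballI less_imp_le[OF I]) auto
    moreover have "G \<subseteq> {m..}" using G(3) by auto
    ultimately show ?thesis
      unfolding step_def by (intro exI[of _ G] exI[of _ a]) (simp add: less_imp_le)
  qed
  then obtain G a where step: "\<And>m. step m (G m) (a m)"
    by metis
  have G: "\<And>m. finite (G m)" "\<And>m. G m \<noteq> {}" "\<And>m. G m \<subseteq> {m..}"
    and a: "\<And>m i. 0 \<le> a m i" "\<And>m. sum (a m) (G m) = 1"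
      "\<And>m. norm (\<Sum>i\<in>G m. a m i *\<^sub>R (fs i - hs i)) \<le> (1/2)^m"
    and close: "\<And>m i q. i \<in> G m \<Longrightarrow> q \<in> \<Union>(Q ` {..m}) \<Longrightarrow> \<bar>apply_bcontfun (fs i) q - f q\<bar> \<le> \<eta> m"
    using step unfolding step_def by blast+
  define p where "p = rec_nat 0 (\<lambda>_ m. Suc (Max (G m)))"
  define F where "F n = G (p n)" for n
  \<comment> \<open>The weights of the separate blocks are glued into one sequence; the
    \<open>LEAST\<close> recovers the interval from \<open>p n\<close> to \<open>p (Suc n)\<close>
    that contains \<open>i\<close>.\<close>
  define c where "c i = a (p (LEAST n. i < p (Suc n))) i" for i
  have p_Suc: "p (Suc n) = Suc (Max (G (p n)))" for n
    by (simp add: p_def)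
  have F_sub: "F n \<subseteq> {p n..<p (Suc n)}" for n
    using G(1,3)[of "p n"] by (auto simp: F_def p_Suc le_imp_less_Suc)
  have p_less: "p n < p (Suc n)" for n
    using F_sub[of n] G(2)[of "p n"] by (auto simp: F_def)
  have p_mono: "strict_mono p"
    using p_less by (rule strict_mono_Suc_iff[THEN iffD2, rule_format])
  have p_ge: "n \<le> p n" for n
    using p_mono by (rule strict_mono_imp_increasing)
  have c_eq: "c i = a (p n) i" if "i \<in> F n" for i n
  proof -
    have i: "p n \<le> i" "i < p (Suc n)"
      using F_sub[of n] that by auto
    have "(LEAST n. i < p (Suc n)) = n"
    proof (rule Least_equality)
      fix m assume "i < p (Suc m)"
      with i(1) have "p n < p (Suc m)" by simp
      then show "n \<le> m"
        using strict_mono_less[OF p_mono] by simp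
    qed (rule i)
    then show ?thesis by (simp add: c_def)
  qed
  have pow: "(1/2::real)^p n \<le> (1/2)^n" for n
    using p_ge by (intro power_decreasing) auto
  have \<eta>_p: "\<eta> (p n) \<le> \<eta> n" for n
    using p_ge \<eta>_dec by (simp add: decseq_def)
  show thesis
  proof (rule that[of p F c])
    show "sum c (F n) = 1" for n
      using a(2)[of "p n"] c_eq by (simp add: F_def cong: sum.cong)
    show "norm (\<Sum>i\<in>F n. c i *\<^sub>R (fs i - hs i)) \<le> (1/2)^n" for n
    proof -
      have "(\<Sum>i\<in>F n. c i *\<^sub>R (fs i - hs i)) = (\<Sum>i\<in>G (p n). a (p n) i *\<^sub>R (fs i - hs i))"
        using c_eq by (intro sum.cong) (auto simp: F_def)
      then show ?thesis
        using order_trans[OF a(3) pow] by simp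
    qed
    show "\<exists>Q. (\<forall>k. \<exists>q\<in>Q. \<bar>f k - f q\<bar> \<le> \<eta> n \<and> (\<forall>i<p n. \<bar>apply_bcontfun (fs i) k - apply_bcontfun (fs i) q\<bar> \<le> \<eta> n)) \<and>
      (\<forall>j\<ge>n. \<forall>i\<in>F j. \<forall>q\<in>Q. \<bar>apply_bcontfun (fs i) q - f q\<bar> \<le> \<eta> j)" for n
    \<comment> \<open>The net for all indices below \<open>p n\<close> covers the functions of the
      earlier blocks. It is among the nets respected by every block \<open>j \<ge> n\<close>,
      because \<open>p n \<le> p j\<close>.\<close>
    proof (intro exI[of _ "Q (p n)"] conjI allI ballI impI)
      show "\<exists>q\<in>Q (p n). \<bar>f k - f q\<bar> \<le> \<eta> n \<and>
          (\<forall>i<p n. \<bar>apply_bcontfun (fs i) k - apply_bcontfun (fs i) q\<bar> \<le> \<eta> n)" for k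
        using Q[of "p n" k] \<eta>_p[of n] by (meson order_trans)
      fix j i q assume *: "n \<le> j" "i \<in> F j" "q \<in> Q (p n)"
      have "p n \<le> p j"
        using * p_mono by (simp add: strict_mono_less_eq)
      then have "\<bar>apply_bcontfun (fs i) q - f q\<bar> \<le> \<eta> (p j)"
        using * by (intro close) (auto simp: F_def)
      then show "\<bar>apply_bcontfun (fs i) q - f q\<bar> \<le> \<eta> j"
        using \<eta>_p order_trans by blast
    qed
  qed (use G a p_mono F_sub in \<open>auto simp: F_def c_def\<close>)
qed

section \<open>Distance from the continuous functions and the basic sequence of differences\<close>

lemma discontinuous_far_from_continuous:
  fixes f :: "'a::metric_space \<Rightarrow> real"
  assumes "\<not> continuous_on UNIV f"
  shows "\<exists>\<delta>>0. \<forall>(y :: 'a \<Rightarrow>\<^sub>C real) a. \<exists>k. \<delta> * \<bar>a\<bar> \<le> \<bar>apply_bcontfun y k + a * f k\<bar>"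
proof (rule ccontr)
  assume neg: "\<not> ?thesis"
  \<comment> \<open>The strict inequality excludes \<open>a = 0\<close>, and division by
    \<open>- a\<close> turns it into a uniform approximation of \<open>f\<close> within
    \<open>\<delta>\<close>.\<close>
  have near: "\<exists>z :: 'a \<Rightarrow>\<^sub>C real. \<forall>k. \<bar>apply_bcontfun z k - f k\<bar> < \<delta>" if "0 < \<delta>" for \<delta>
  proof -
    obtain y :: "'a \<Rightarrow>\<^sub>C real" and a where ya: "\<And>k. \<bar>apply_bcontfun y k + a * f k\<bar> < \<delta> * \<bar>a\<bar>"
      using neg \<open>0 < \<delta>\<close> by (meson not_le)
    have "a \<noteq> 0" using ya[of undefined] by auto
    have "\<bar>apply_bcontfun ((- 1 / a) *\<^sub>R y) k - f k\<bar> < \<delta>" for k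
    proof -
      have "apply_bcontfun ((- 1 / a) *\<^sub>R y) k - f k = - (apply_bcontfun y k + a * f k) / a"
        using \<open>a \<noteq> 0\<close> by (simp add: field_simps)
      then show ?thesis
        using ya[of k] \<open>a \<noteq> 0\<close> by (simp add: abs_divide divide_less_eq)
    qed
    then show ?thesis by blast
  qed
  then obtain z :: "nat \<Rightarrow> 'a \<Rightarrow>\<^sub>C real"
    where z: "\<And>n k. \<bar>apply_bcontfun (z n) k - f k\<bar> < 1 / real (Suc n)"
  proof -
    have "\<exists>z :: 'a \<Rightarrow>\<^sub>C real. \<forall>k. \<bar>apply_bcontfun z k - f k\<bar> < 1 / real (Suc n)" for n
      using near by simp
    with that show thesis by metis
  qed
  have "uniform_limit UNIV (\<lambda>n. apply_bcontfun (z n)) f sequentially"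
  proof (rule uniform_limitI)
    fix e :: real assume "0 < e"
    then obtain M where M: "1 / real (Suc M) < e"
      using nat_approx_posE by blast
    have "dist (apply_bcontfun (z n) k) (f k) < e" if "M \<le> n" for n k
    proof -
      have "1 / real (Suc n) \<le> 1 / real (Suc M)"
        using that by (intro divide_left_mono) auto
      then show ?thesis
        using z[of n k] M by (simp add: dist_real_def)
    qed
    then show "\<forall>\<^sub>F n in sequentially. \<forall>k\<in>UNIV. dist (apply_bcontfun (z n) k) (f k) < e"
      by (auto simp: eventually_sequentially)
  qed
  then have "continuous_on UNIV f"
    by (rule uniform_limit_theorem[rotated]) (auto intro: always_eventually)
  with assms show False ..
qed

text \<open>The initial term \<open>g 0\<close> makes the partial sums telescope to
  \<open>g n\<close>, so the span is that of \<open>g\<close>.\<close>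

definition differences :: "(nat \<Rightarrow> 'b::ab_group_add) \<Rightarrow> nat \<Rightarrow> 'b" where
  "differences g n = (case n of 0 \<Rightarrow> g 0 | Suc m \<Rightarrow> g (Suc m) - g m)"

text \<open>Summation by parts; it separates a head of fixed functions \<open>g i\<close> from the
  boundary term \<open>\<beta> n *\<^sub>R g n\<close>, in which \<open>g n\<close> can be exchanged
  for \<open>f\<close>.\<close>

lemma sum_differences:
  fixes g :: "nat \<Rightarrow> 'b::real_vector"
  shows "(\<Sum>i\<le>n. \<beta> i *\<^sub>R differences g i) = (\<Sum>i<n. (\<beta> i - \<beta> (Suc i)) *\<^sub>R g i) + \<beta> n *\<^sub>R g n"
  by (induction n) (simp_all add: differences_def algebra_simps)

lemma span_differences:
  fixes g :: "nat \<Rightarrow> 'b::real_vector"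
  shows "span (range (differences g)) = span (range g)"
proof (rule span_eq[THEN iffD2], intro conjI; safe)
  fix n
  show "differences g n \<in> span (range g)"
    by (cases n) (auto simp: differences_def intro: span_base span_diff)
  have "g n = (\<Sum>i\<le>n. differences g i)"
    using sum_differences[of "\<lambda>_. 1" g n] by simp
  then show "g n \<in> span (range (differences g))"
    by (auto intro: span_sum span_base)
qed

text \<open>Replacing the tail of a combination by the same multiple of the discontinuous limit \<open>f\<close>
  changes it little on a net that norms the head together with \<open>f\<close>; the distance of \<open>f\<close> from the
  continuous functions then controls that multiple.\<close>

lemma basic_sequence_differences:
  fixes g :: "nat \<Rightarrow> 'a::metric_space \<Rightarrow>\<^sub>C real" and f :: "'a \<Rightarrow> real"
  assumes g_le: "\<And>n k. \<bar>apply_bcontfun (g n) k\<bar> \<le> B" and f_le: "\<And>k. \<bar>f k\<bar> \<le> B"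
    and \<delta>: "0 < \<delta>"
    and far: "\<And>(y :: 'a \<Rightarrow>\<^sub>C real) a. \<exists>k. \<delta> * \<bar>a\<bar> \<le> \<bar>apply_bcontfun y k + a * f k\<bar>"
    and \<eta>: "\<And>n. \<eta> n = \<delta> / 12 * (1/4)^n"
    and nets: "\<And>n. \<exists>Q. (\<forall>k. \<exists>q\<in>Q. \<bar>f k - f q\<bar> \<le> \<eta> n \<and>
        (\<forall>i<n. \<bar>apply_bcontfun (g i) k - apply_bcontfun (g i) q\<bar> \<le> \<eta> n)) \<and>
      (\<forall>j\<ge>n. \<forall>q\<in>Q. \<bar>apply_bcontfun (g j) q - f q\<bar> \<le> \<eta> j)"
  shows "basic_sequence (differences g) (2 + 2 / \<delta> + 4 * B / \<delta>)"
proof -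
  have B: "0 \<le> B" using f_le[of undefined] abs_ge_zero order_trans by blast
  have main: "\<bar>\<alpha> n\<bar> \<le> 2 / \<delta> * norm (\<Sum>i\<le>m. \<alpha> i *\<^sub>R differences g i) \<and>
      norm (\<Sum>i\<le>n. \<alpha> i *\<^sub>R differences g i) \<le> (2 + 4 * B / \<delta>) * norm (\<Sum>i\<le>m. \<alpha> i *\<^sub>R differences g i)"
    if "n \<le> m" for \<alpha> :: "nat \<Rightarrow> real" and n m
  proof -
    define x where "x = (\<Sum>i\<le>m. \<alpha> i *\<^sub>R differences g i)"
    \<comment> \<open>Since \<open>\<beta> (Suc m) = 0\<close>, the full combination is
      \<open>y (Suc m)\<close> without a boundary term.\<close>
    define \<beta> where "\<beta> i = (if i \<le> m then \<alpha> i else 0)" for i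
    define A where "A = Max ((\<lambda>i. \<bar>\<beta> i\<bar>) ` {..m})"
    define y where "y n = (\<Sum>i<n. (\<beta> i - \<beta> (Suc i)) *\<^sub>R g i)" for n
    have \<beta>_le: "\<bar>\<beta> i\<bar> \<le> A" for i
    proof -
      have "\<bar>\<beta> j\<bar> \<le> A" if "j \<le> m" for j
        unfolding A_def using that by (intro Max_ge) auto
      from this[of i] this[of 0] show ?thesis by (auto simp: \<beta>_def)
    qed
    then have A: "0 \<le> A" using abs_ge_zero order_trans by blast
    have \<beta>_diff: "\<bar>\<beta> i - \<beta> (Suc i)\<bar> \<le> 2 * A" for i
      using \<beta>_le[of i] \<beta>_le[of "Suc i"] by linarith
    have partial: "(\<Sum>i\<le>n. \<alpha> i *\<^sub>R differences g i) = y n + \<beta> n *\<^sub>R g n" if "n \<le> m" for n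
    proof -
      have "(\<Sum>i\<le>n. \<alpha> i *\<^sub>R differences g i) = (\<Sum>i\<le>n. \<beta> i *\<^sub>R differences g i)"
        using that by (intro sum.cong) (auto simp: \<beta>_def)
      then show ?thesis by (simp add: sum_differences y_def)
    qed
    have x: "x = y (Suc m)"
      using partial[of m] by (simp add: x_def y_def \<beta>_def)
    have \<eta>_sum: "(\<Sum>i\<in>{n..m}. \<eta> i) \<le> \<delta> / 9" for n
    proof -
      have "(\<Sum>i\<in>{n..m}. (1/4::real)^i) \<le> (\<Sum>i. (1/4)^i)"
        by (intro sum_le_suminf summable_geometric) auto
      also have "\<dots> = 4/3"
        by (simp add: suminf_geometric)
      finally have "\<delta> / 12 * (\<Sum>i\<in>{n..m}. (1/4)^i) \<le> \<delta> / 12 * (4/3)"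
        using \<delta> by (intro mult_left_mono) auto
      then show ?thesis
        unfolding \<eta> sum_distrib_left[symmetric] by simp
    qed
    \<comment> \<open>The errors add up to
      \<open>2 * A * (\<delta> / 9) + A * (\<delta> / 12)\<close>, at most half of the lower bound
      \<open>\<delta> * A\<close> that \<open>far\<close> yields when
      \<open>\<bar>\<beta> n\<bar> = A\<close>.\<close>
    have head: "\<bar>apply_bcontfun (y n) k + \<beta> n * f k\<bar> \<le> norm x + A * \<delta> / 2" if "n \<le> m" for n k
    proof -
      obtain Q where Q: "\<And>k. \<exists>q\<in>Q. \<bar>f k - f q\<bar> \<le> \<eta> n \<and>
          (\<forall>i<n. \<bar>apply_bcontfun (g i) k - apply_bcontfun (g i) q\<bar> \<le> \<eta> n)"
        "\<And>j q. n \<le> j \<Longrightarrow> q \<in> Q \<Longrightarrow> \<bar>apply_bcontfun (g j) q - f q\<bar> \<le> \<eta> j"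
        using nets[of n] by blast
      obtain q where "q \<in> Q" and q: "\<bar>f k - f q\<bar> \<le> \<eta> n"
        "\<And>i. i < n \<Longrightarrow> \<bar>apply_bcontfun (g i) k - apply_bcontfun (g i) q\<bar> \<le> \<eta> n"
        using Q(1) by blast
      have y_apply: "apply_bcontfun (y N) k = (\<Sum>i<N. (\<beta> i - \<beta> (Suc i)) * apply_bcontfun (g i) k)" for N k
        by (simp add: y_def apply_bcontfun_sum)
      \<comment> \<open>The factors \<open>\<beta> i - \<beta> (Suc i)\<close> telescope, so
        replacing every tail function by \<open>f\<close> collapses the tail to one multiple of
        \<open>f q\<close>.\<close>
      have "apply_bcontfun (y N) q = apply_bcontfun (y n) q + (\<beta> n - \<beta> N) * f q
          + (\<Sum>i\<in>{n..<N}. (\<beta> i - \<beta> (Suc i)) * (apply_bcontfun (g i) q - f q))" if "n \<le> N" for N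
        using that by (induction N rule: dec_induct) (simp_all add: y_apply algebra_simps)
      from this[of "Suc m"] \<open>n \<le> m\<close>
      have "apply_bcontfun (y n) q + \<beta> n * f q = apply_bcontfun x q
          - (\<Sum>i\<in>{n..m}. (\<beta> i - \<beta> (Suc i)) * (apply_bcontfun (g i) q - f q))"
        by (simp add: x \<beta>_def atLeastLessThanSuc_atLeastAtMost)
      moreover have "\<bar>\<Sum>i\<in>{n..m}. (\<beta> i - \<beta> (Suc i)) * (apply_bcontfun (g i) q - f q)\<bar> \<le> 2 * A * (\<delta> / 9)"
      proof -
        have "\<bar>\<Sum>i\<in>{n..m}. (\<beta> i - \<beta> (Suc i)) * (apply_bcontfun (g i) q - f q)\<bar>
            \<le> (\<Sum>i\<in>{n..m}. 2 * A * \<eta> i)"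
          using \<beta>_diff A Q(2) \<open>q \<in> Q\<close>
          by (intro order_trans[OF sum_abs] sum_mono) (auto simp: abs_mult intro!: mult_mono)
        also have "\<dots> \<le> 2 * A * (\<delta> / 9)"
          unfolding sum_distrib_left[symmetric] using A \<eta>_sum by (intro mult_left_mono) auto
        finally show ?thesis .
      qed
      moreover have "\<bar>apply_bcontfun x q\<bar> \<le> norm x"
        using norm_bounded[of x q] by simp
      ultimately have at_q: "\<bar>apply_bcontfun (y n) q + \<beta> n * f q\<bar> \<le> norm x + 2 * A * (\<delta> / 9)"
        by linarith
      have "(apply_bcontfun (y n) k + \<beta> n * f k) - (apply_bcontfun (y n) q + \<beta> n * f q)
          = (\<Sum>i<n. (\<beta> i - \<beta> (Suc i)) * (apply_bcontfun (g i) k - apply_bcontfun (g i) q)) + \<beta> n * (f k - f q)"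
        by (simp add: y_apply right_diff_distrib sum_subtractf)
      also have "\<bar>\<dots>\<bar> \<le> (\<Sum>i<n. 2 * A * \<eta> n) + A * \<eta> n"
      proof (intro order_trans[OF abs_triangle_ineq] add_mono)
        show "\<bar>\<Sum>i<n. (\<beta> i - \<beta> (Suc i)) * (apply_bcontfun (g i) k - apply_bcontfun (g i) q)\<bar> \<le> (\<Sum>i<n. 2 * A * \<eta> n)"
          using \<beta>_diff A q(2)
          by (intro order_trans[OF sum_abs] sum_mono) (auto simp: abs_mult intro!: mult_mono)
        show "\<bar>\<beta> n * (f k - f q)\<bar> \<le> A * \<eta> n"
          using \<beta>_le A q(1) by (auto simp: abs_mult intro!: mult_mono)
      qed
      also have "\<dots> = A * (\<delta> / 12) * ((2 * real n + 1) * (1/4)^n)"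
        by (simp add: \<eta> algebra_simps)
      \<comment> \<open>The net tolerance outweighs the number of head terms, as
        \<open>2 * real n + 1 \<le> 4^n\<close>.\<close>
      also have "\<dots> \<le> A * (\<delta> / 12) * 1"
      proof (rule mult_left_mono)
        have "2 * real n + 1 \<le> 4^n"
          by (induction n) auto
        then show "(2 * real n + 1) * (1/4)^n \<le> 1"
          by (simp add: power_divide)
      qed (use A \<delta> in simp)
      finally have "\<bar>apply_bcontfun (y n) k + \<beta> n * f k\<bar> \<le> norm x + 2 * A * (\<delta> / 9) + A * (\<delta> / 12)"
        using at_q by linarith
      also have "\<dots> \<le> norm x + A * \<delta> / 2"
        using mult_nonneg_nonneg[OF A less_imp_le[OF \<delta>]] by simp
      finally show ?thesis .
    qed
    \<comment> \<open>At an index \<open>l\<close> with the largest coefficient, \<open>far\<close>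
      and \<open>head\<close> give \<open>\<delta> * A \<le> norm x + A * \<delta> / 2\<close>,
      which bounds all coefficients at once.\<close>
    have "A \<in> (\<lambda>i. \<bar>\<beta> i\<bar>) ` {..m}"
      unfolding A_def by (intro Max_in) auto
    then obtain l where l: "l \<le> m" "A = \<bar>\<beta> l\<bar>" by auto
    obtain k where "\<delta> * \<bar>\<beta> l\<bar> \<le> \<bar>apply_bcontfun (y l) k + \<beta> l * f k\<bar>"
      using far by blast
    with head[OF l(1), of k] have A_le: "A * \<delta> / 2 \<le> norm x"
      by (simp add: l(2)[symmetric] mult.commute)
    then have A_le': "A \<le> 2 / \<delta> * norm x"
      using \<delta> by (simp add: field_simps)
    \<comment> \<open>Changing \<open>f\<close> back to \<open>g n\<close> costs at most
      \<open>\<bar>\<beta> n\<bar>\<close> times \<open>2 * B\<close>, which \<open>norm x\<close>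
      now controls.\<close>
    have "norm (y n + \<beta> n *\<^sub>R g n) \<le> (2 + 4 * B / \<delta>) * norm x"
    proof (rule norm_bound)
      fix k
      have "\<bar>apply_bcontfun (y n) k + \<beta> n * f k\<bar> \<le> 2 * norm x"
        using head[OF that, of k] A_le by simp
      moreover have "\<bar>\<beta> n * (apply_bcontfun (g n) k - f k)\<bar> \<le> 2 / \<delta> * norm x * (2 * B)"
        unfolding abs_mult
      proof (rule mult_mono)
        show "\<bar>\<beta> n\<bar> \<le> 2 / \<delta> * norm x"
          using \<beta>_le A_le' order_trans by blast
        show "\<bar>apply_bcontfun (g n) k - f k\<bar> \<le> 2 * B"
          using g_le[of n k] f_le[of k] by linarith
      qed (use \<delta> in auto)
      moreover have "apply_bcontfun (y n + \<beta> n *\<^sub>R g n) k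
          = (apply_bcontfun (y n) k + \<beta> n * f k) + \<beta> n * (apply_bcontfun (g n) k - f k)"
        by (simp add: algebra_simps)
      moreover have "(2 + 4 * B / \<delta>) * norm x = 2 * norm x + 2 / \<delta> * norm x * (2 * B)"
        by (simp add: algebra_simps)
      ultimately show "norm (apply_bcontfun (y n + \<beta> n *\<^sub>R g n) k) \<le> (2 + 4 * B / \<delta>) * norm x"
        unfolding real_norm_def by linarith
    qed
    moreover have "\<bar>\<alpha> n\<bar> \<le> 2 / \<delta> * norm x"
      using order_trans[OF \<beta>_le A_le', of n] that by (simp add: \<beta>_def)
    ultimately show ?thesis
      using partial[OF that] by (simp add: x_def)
  qed
  show ?thesis
  proof
    fix n m :: nat and \<alpha> :: "nat \<Rightarrow> real" assume "n \<le> m"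
    note m = main[OF this, of \<alpha>]
    let ?x = "norm (\<Sum>i\<le>m. \<alpha> i *\<^sub>R differences g i)"
    have "2 / \<delta> * ?x \<le> (2 + 2 / \<delta> + 4 * B / \<delta>) * ?x" "(2 + 4 * B / \<delta>) * ?x \<le> (2 + 2 / \<delta> + 4 * B / \<delta>) * ?x"
      using \<delta> B by (intro mult_right_mono; simp)+
    with m show "\<bar>\<alpha> n\<bar> \<le> (2 + 2 / \<delta> + 4 * B / \<delta>) * ?x"
      "norm (\<Sum>i\<le>n. \<alpha> i *\<^sub>R differences g i) \<le> (2 + 2 / \<delta> + 4 * B / \<delta>) * ?x"
      by linarith+
  qed
qed

text \<open>A convex average over a block differs from an endpoint value by at most the variation of
  \<open>h\<close> on that block, and these variations telescope.\<close>

lemma summable_convex_block_differences: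
  fixes h :: "nat \<Rightarrow> real"
  assumes summ: "summable (\<lambda>n. \<bar>h (Suc n) - h n\<bar>)"
    and p: "strict_mono (p :: nat \<Rightarrow> nat)" and F: "\<And>n. F n \<subseteq> {p n..<p (Suc n)}"
    and c: "\<And>i. 0 \<le> c i" "\<And>n. sum c (F n) = 1"
  shows "summable (\<lambda>n. \<bar>(\<Sum>i\<in>F (Suc n). c i * h i) - (\<Sum>i\<in>F n. c i * h i)\<bar>)"
proof -
  define D where "D m = (\<Sum>i<m. \<bar>h (Suc i) - h i\<bar>)" for m
  define E where "E n = D (p n)" for n
  have D_mono: "D i \<le> D j" if "i \<le> j" for i j
    unfolding D_def using that by (intro sum_mono2) auto
  have h_diff: "\<bar>h j - h i\<bar> \<le> D j - D i" if "i \<le> j" for i j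
    using that by (induction j rule: dec_induct) (auto simp: D_def)
  \<comment> \<open>Consecutive blocks are compared through their common endpoint
    \<open>p (Suc n)\<close>: \<open>left\<close> serves block \<open>n\<close>, and
    \<open>right\<close> serves block \<open>Suc n\<close>.\<close>
  have left: "\<bar>(\<Sum>i\<in>F n. c i * h i) - h (p (Suc n))\<bar> \<le> E (Suc n) - E n" for n
    unfolding convex_combination_diff[OF c(2)]
  proof (intro convex_combination_abs_le c)
    fix i assume "i \<in> F n"
    then have "p n \<le> i" "i \<le> p (Suc n)" using F[of n] by auto
    then show "\<bar>h i - h (p (Suc n))\<bar> \<le> E (Suc n) - E n"
      using h_diff[of i "p (Suc n)"] D_mono[of "p n" i] by (simp add: E_def abs_minus_commute)
  qed
  have right: "\<bar>(\<Sum>i\<in>F n. c i * h i) - h (p n)\<bar> \<le> E (Suc n) - E n" for n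
    unfolding convex_combination_diff[OF c(2)]
  proof (intro convex_combination_abs_le c)
    fix i assume "i \<in> F n"
    then have "p n \<le> i" "i \<le> p (Suc n)" using F[of n] by auto
    then show "\<bar>h i - h (p n)\<bar> \<le> E (Suc n) - E n"
      using h_diff[of "p n" i] D_mono[of i "p (Suc n)"] by (simp add: E_def)
  qed
  have "E \<longlonglongrightarrow> (\<Sum>i. \<bar>h (Suc i) - h i\<bar>)"
    using LIMSEQ_subseq_LIMSEQ[OF summable_LIMSEQ[OF summ] p] by (simp add: E_def[abs_def] D_def o_def)
  then have E: "summable (\<lambda>n. E (Suc n) - E n)"
    by (rule telescope_summable)
  show ?thesis
  proof (rule summable_comparison_test')
    show "summable (\<lambda>n. (E (Suc (Suc n)) - E (Suc n)) + (E (Suc n) - E n))"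
      using E summable_Suc_iff[of "\<lambda>n. E (Suc n) - E n"] by (intro summable_add) auto
    show "norm \<bar>(\<Sum>i\<in>F (Suc n). c i * h i) - (\<Sum>i\<in>F n. c i * h i)\<bar>
        \<le> (E (Suc (Suc n)) - E (Suc n)) + (E (Suc n) - E n)" for n
      using left[of n] right[of "Suc n"] unfolding real_norm_def by linarith
  qed
qed

section \<open>Assembly of the blocks and the renorming\<close>

theorem theorem1p7:
  fixes f :: "'a::metric_space \<Rightarrow> real"
  assumes "compact (UNIV :: 'a set)"
    and "f \<in> DSC"
    and "\<not> continuous_on UNIV f"
  shows "\<forall>fs :: nat \<Rightarrow> ('a \<Rightarrow>\<^sub>C real).
           (\<exists>B. \<forall>n. norm (fs n) \<le> B) \<and> (\<forall>k. (\<lambda>n. apply_bcontfun (fs n) k) \<longlonglongrightarrow> f k) \<longrightarrow>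
           (\<exists>g. convex_block_seq g fs \<and>
              (\<exists>(W :: ('a \<Rightarrow>\<^sub>C real) set) N.
                  banach_on W N \<and> separable_on W N \<and> polyhedral_on W N \<and>
                  isomorphic_on (closure (span (range g))) W N))"
proof (intro allI impI, elim conjE exE)
  fix fs :: "nat \<Rightarrow> 'a \<Rightarrow>\<^sub>C real" and B
  assume "\<forall>n. norm (fs n) \<le> B" and "\<forall>k. (\<lambda>n. apply_bcontfun (fs n) k) \<longlonglongrightarrow> f k"
  then have fs_bd: "\<And>n. norm (fs n) \<le> B" and fs_lim: "\<And>k. (\<lambda>n. apply_bcontfun (fs n) k) \<longlonglongrightarrow> f k"
    by blast+
  obtain hs :: "nat \<Rightarrow> 'a \<Rightarrow>\<^sub>C real" and B' where hs_bd: "\<And>n. norm (hs n) \<le> B'"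
    and hs_lim: "\<And>k. (\<lambda>n. apply_bcontfun (hs n) k) \<longlonglongrightarrow> f k"
    and hs_summ: "\<And>k. summable (\<lambda>n. \<bar>apply_bcontfun (hs (Suc n)) k - apply_bcontfun (hs n) k\<bar>)"
    using assms(2) unfolding DSC_def by blast
  obtain \<delta> where \<delta>: "0 < \<delta>"
    and far: "\<And>(y :: 'a \<Rightarrow>\<^sub>C real) a. \<exists>k. \<delta> * \<bar>a\<bar> \<le> \<bar>apply_bcontfun y k + a * f k\<bar>"
    using discontinuous_far_from_continuous[OF assms(3)] by blast
  \<comment> \<open>As \<open>basic_sequence_differences\<close> requires, these tolerances sum to a
    small fraction of \<open>\<delta>\<close> and decay fast enough to absorb a factor linear in
    \<open>n\<close>.\<close>
  define \<eta> :: "nat \<Rightarrow> real" where "\<eta> n = \<delta> / 12 * (1/4)^n" for n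
  have \<eta>_pos: "0 < \<eta> n" for n
    using \<delta> by (simp add: \<eta>_def)
  have \<eta>_dec: "decseq \<eta>"
    unfolding decseq_def \<eta>_def using \<delta> by (intro allI impI mult_left_mono power_decreasing) auto
  obtain F c p where p: "strict_mono (p :: nat \<Rightarrow> nat)"
    and F: "\<And>n. finite (F n)" "\<And>n. F n \<noteq> {}" "\<And>n. F n \<subseteq> {p n..<p (Suc n)}"
    and c: "\<And>i. 0 \<le> c i" "\<And>n. sum c (F n) = 1"
    and small: "\<And>n. norm (\<Sum>i\<in>F n. c i *\<^sub>R (fs i - hs i)) \<le> (1/2)^n"
    and nets: "\<And>n. \<exists>Q. (\<forall>k. \<exists>q\<in>Q. \<bar>f k - f q\<bar> \<le> \<eta> n \<and>
        (\<forall>i<p n. \<bar>apply_bcontfun (fs i) k - apply_bcontfun (fs i) q\<bar> \<le> \<eta> n)) \<and>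
      (\<forall>j\<ge>n. \<forall>i\<in>F j. \<forall>q\<in>Q. \<bar>apply_bcontfun (fs i) q - f q\<bar> \<le> \<eta> j)"
    by (rule convex_block_selection[OF assms(1) fs_bd hs_bd fs_lim hs_lim \<eta>_pos \<eta>_dec]) (rule that)
  define g where "g n = (\<Sum>i\<in>F n. c i *\<^sub>R fs i)" for n
  have g_apply: "apply_bcontfun (g n) k = (\<Sum>i\<in>F n. c i * apply_bcontfun (fs i) k)" for n k
    by (simp add: g_def apply_bcontfun_sum)
  have "i < j" if "i \<in> F n" "j \<in> F (Suc n)" for i j n
    using F(3)[of n] F(3)[of "Suc n"] that by fastforce
  then have block: "convex_block_seq g fs"
    unfolding convex_block_seq_def using F(1,2) c g_def
    by (intro exI[of _ F] exI[of _ c] conjI allI ballI) auto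
  have fs_le: "\<bar>apply_bcontfun (fs i) k\<bar> \<le> B" for i k
    using norm_bounded[of "fs i" k] fs_bd[of i] by simp
  have f_le: "\<bar>f k\<bar> \<le> B" for k
    by (rule LIMSEQ_le_const2[OF tendsto_rabs[OF fs_lim]]) (use fs_le in blast)
  have g_le: "\<bar>apply_bcontfun (g n) k\<bar> \<le> B" for n k
    unfolding g_apply by (intro convex_combination_abs_le c fs_le)
  \<comment> \<open>Estimates on the \<open>fs\<close> pass to convex combinations; blocks before
    \<open>n\<close> use only indices below \<open>p n\<close>, which the net covers.\<close>
  have g_nets: "\<exists>Q. (\<forall>k. \<exists>q\<in>Q. \<bar>f k - f q\<bar> \<le> \<eta> n \<and>
        (\<forall>i<n. \<bar>apply_bcontfun (g i) k - apply_bcontfun (g i) q\<bar> \<le> \<eta> n)) \<and>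
      (\<forall>j\<ge>n. \<forall>q\<in>Q. \<bar>apply_bcontfun (g j) q - f q\<bar> \<le> \<eta> j)" for n
  proof -
    obtain Q where Q: "\<And>k. \<exists>q\<in>Q. \<bar>f k - f q\<bar> \<le> \<eta> n \<and>
        (\<forall>i<p n. \<bar>apply_bcontfun (fs i) k - apply_bcontfun (fs i) q\<bar> \<le> \<eta> n)"
      "\<And>j i q. n \<le> j \<Longrightarrow> i \<in> F j \<Longrightarrow> q \<in> Q \<Longrightarrow> \<bar>apply_bcontfun (fs i) q - f q\<bar> \<le> \<eta> j"
      using nets[of n] by blast
    show ?thesis
    proof (intro exI[of _ Q] conjI allI ballI impI)
      fix k
      obtain q where "q \<in> Q" and q: "\<bar>f k - f q\<bar> \<le> \<eta> n"
        "\<And>i. i < p n \<Longrightarrow> \<bar>apply_bcontfun (fs i) k - apply_bcontfun (fs i) q\<bar> \<le> \<eta> n"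
        using Q(1) by blast
      have "\<bar>apply_bcontfun (g m) k - apply_bcontfun (g m) q\<bar> \<le> \<eta> n" if "m < n" for m
      proof -
        have "apply_bcontfun (g m) k - apply_bcontfun (g m) q
            = (\<Sum>i\<in>F m. c i * (apply_bcontfun (fs i) k - apply_bcontfun (fs i) q))"
          by (simp add: g_apply right_diff_distrib sum_subtractf)
        also have "\<bar>\<dots>\<bar> \<le> \<eta> n"
        proof (intro convex_combination_abs_le c q(2))
          fix i assume "i \<in> F m"
          then have "i < p (Suc m)" using F(3)[of m] by auto
          also have "p (Suc m) \<le> p n"
            using that p by (simp add: strict_mono_less_eq)
          finally show "i < p n" .
        qed
        finally show ?thesis .
      qed
      with q(1) \<open>q \<in> Q\<close> show "\<exists>q\<in>Q. \<bar>f k - f q\<bar> \<le> \<eta> n \<and>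
          (\<forall>i<n. \<bar>apply_bcontfun (g i) k - apply_bcontfun (g i) q\<bar> \<le> \<eta> n)"
        by blast
    next
      fix j q assume "n \<le> j" "q \<in> Q"
      then show "\<bar>apply_bcontfun (g j) q - f q\<bar> \<le> \<eta> j"
        unfolding g_apply convex_combination_diff[OF c(2)]
        by (intro convex_combination_abs_le c Q(2))
    qed
  qed
  interpret basic_sequence "differences g" "2 + 2 / \<delta> + 4 * B / \<delta>"
    by (rule basic_sequence_differences[OF g_le f_le \<delta> far \<eta>_def g_nets])
  interpret absolutely_summable_basic_sequence "differences g" "2 + 2 / \<delta> + 4 * B / \<delta>"
  proof
    fix k
    \<comment> \<open>The same weights applied to \<open>hs\<close> give averages within
      \<open>(1/2)^n\<close> of \<open>g n\<close>, so summability of the differences carries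
      over.\<close>
    define h where "h n = (\<Sum>i\<in>F n. c i * apply_bcontfun (hs i) k)" for n
    have close: "\<bar>apply_bcontfun (g n) k - h n\<bar> \<le> (1/2)^n" for n
    proof -
      have "apply_bcontfun (g n) k - h n = apply_bcontfun (\<Sum>i\<in>F n. c i *\<^sub>R (fs i - hs i)) k"
        by (simp add: g_apply h_def apply_bcontfun_sum right_diff_distrib sum_subtractf)
      then show ?thesis
        using norm_bounded[of "\<Sum>i\<in>F n. c i *\<^sub>R (fs i - hs i)" k] small[of n] by simp
    qed
    have "summable (\<lambda>n. \<bar>apply_bcontfun (g (Suc n)) k - apply_bcontfun (g n) k\<bar>)"
    proof (rule summable_comparison_test')
      show "summable (\<lambda>n. \<bar>h (Suc n) - h n\<bar> + ((1/2)^Suc n + (1/2)^n))"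
        unfolding h_def
        by (intro summable_add summable_convex_block_differences[OF hs_summ p F(3) c])
          (simp_all add: summable_mult)
      show "norm \<bar>apply_bcontfun (g (Suc n)) k - apply_bcontfun (g n) k\<bar>
          \<le> \<bar>h (Suc n) - h n\<bar> + ((1/2)^Suc n + (1/2)^n)" for n
        using close[of n] close[of "Suc n"] unfolding real_norm_def by linarith
    qed
    \<comment> \<open>The index shift drops the initial term \<open>g 0\<close> of
      \<open>differences g\<close>.\<close>
    then show "summable (\<lambda>i. \<bar>apply_bcontfun (differences g i) k\<bar>)"
      by (subst summable_Suc_iff[symmetric]) (simp add: differences_def)
  qed (rule assms(1))
  \<comment> \<open>The blocks span \<open>W\<close> itself, so the identity is the required
    isomorphism onto \<open>W\<close> with the norm \<open>N\<close>.\<close>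
  have "closure (span (range g)) = W"
    by (simp add: W_def span_differences)
  then show "\<exists>g. convex_block_seq g fs \<and>
      (\<exists>(W :: ('a \<Rightarrow>\<^sub>C real) set) N.
          banach_on W N \<and> separable_on W N \<and> polyhedral_on W N \<and>
          isomorphic_on (closure (span (range g))) W N)"
    using block banach_on_N separable_on_N polyhedral_on_N isomorphic_on_N by metis
qed

end
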